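(* Let $(\rho(\theta))_{\theta\in\mathbb{R}^L}$ be a second-order differentiable family of positive definite states on a finite-dimensional Hilbert space. For all $\theta\in\mathbb{R}^L$, the matrix-valued function $\alpha\mapsto\widetilde I_\alpha(\theta)$ (the sandwiched Rényi information matrix) is monotone increasing on $\alpha\in(0,\infty)$, with respect to the Loewner order.
   Context: A state is a positive semi-definite operator of unit trace. For positive definite states $\rho,\sigma$ and $\alpha\in(0,1)\cup(1,\infty)$, the sandwiched Rényi relative entropy is $\widetilde D_\alpha(\rho\|\sigma):=\frac{1}{\alpha-1}\ln\mathrm{Tr}\big[(\sigma^{\frac{1-\alpha}{2\alpha}}\rho\,\sigma^{\frac{1-\alpha}{2\alpha}})^\alpha\big]$, and the sandwiched Rényi information matrix is the $L\times L$ matrix with entries $[\widetilde I_\alpha(\theta)]_{i,j}:=\frac1\alpha\left.\frac{\partial^2}{\partial\varepsilon_i\partial\varepsilon_j}\widetilde D_\alpha(\rho(\theta)\|\rho(\theta+\varepsilon))\right|_{\varepsilon=0}$. At $\alpha=1$, $\widetilde I_1(\theta)$ is understood as the limit $\lim_{\alpha\to1}\widetilde I_\alpha(\theta)$, which is the Kubo--Mori information matrix with entries $\left.\frac{\partial^2}{\partial\varepsilon_i\partial\varepsilon_j}\mathrm{Tr}[\rho(\theta)(\ln\rho(\theta)-\ln\rho(\theta+\varepsilon))]\right|_{\varepsilon=0}$. Monotone increasing is meant in the non-strict sense; the Loewner order is $A\le B$ iff $B-A$ is positive semi-definite. *)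

theory Defs
  imports "HOL-Analysis.Analysis"
begin

text \<open>
  A finite-dimensional Hilbert space is represented by \<open>complex ^ 'n\<close>, with operators as square
  matrices over it. The library provides no Hermitian inner product on this type (its \<open>inner\<close> is the
  real part), so the Hermitian notions are introduced here.
\<close>

definition cdot :: "complex ^ 'n \<Rightarrow> complex ^ 'n \<Rightarrow> complex" where
  "cdot v w = (\<Sum>i\<in>UNIV. cnj (v $ i) * w $ i)"

definition cadj :: "complex ^ 'n ^ 'n \<Rightarrow> complex ^ 'n ^ 'n" where
  "cadj A = (\<chi> i j. cnj (A $ j $ i))"

definition unitary :: "complex ^ 'n ^ 'n \<Rightarrow> bool" where
  "unitary U \<longleftrightarrow> cadj U ** U = mat 1 \<and> U ** cadj U = mat 1"

definition pos_semidef :: "complex ^ 'n ^ 'n \<Rightarrow> bool" where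
  "pos_semidef A \<longleftrightarrow> cadj A = A \<and> (\<forall>v. 0 \<le> Re (cdot v (A *v v)))"

definition pos_def :: "complex ^ 'n ^ 'n \<Rightarrow> bool" where
  "pos_def A \<longleftrightarrow> cadj A = A \<and> (\<forall>v. v \<noteq> 0 \<longrightarrow> 0 < Re (cdot v (A *v v)))"

definition state :: "complex ^ 'n ^ 'n \<Rightarrow> bool" where
  "state \<rho> \<longleftrightarrow> pos_semidef \<rho> \<and> trace \<rho> = 1"

definition real_diag :: "('n \<Rightarrow> real) \<Rightarrow> complex ^ 'n ^ 'n" where
  "real_diag d = (\<chi> i j. if i = j then complex_of_real (d i) else 0)"

text \<open>
  Functional calculus for Hermitian matrices. By the spectral theorem a unitary diagonalization
  exists, and the result does not depend on which one is chosen. No meaning is attached to the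
  value at matrices that are not Hermitian.
\<close>

definition mat_fun :: "(real \<Rightarrow> real) \<Rightarrow> complex ^ 'n ^ 'n \<Rightarrow> complex ^ 'n ^ 'n" where
  "mat_fun f A = (THE B. \<exists>U d. unitary U \<and> A = U ** real_diag d ** cadj U
                              \<and> B = U ** real_diag (\<lambda>i. f (d i)) ** cadj U)"

definition mat_powr :: "complex ^ 'n ^ 'n \<Rightarrow> real \<Rightarrow> complex ^ 'n ^ 'n" where
  "mat_powr A r = mat_fun (\<lambda>x. x powr r) A"

text \<open>
  For positive definite arguments the trace below is a positive real number; \<open>Re\<close> only changes
  its type.
\<close>

definition sandwiched_renyi :: "real \<Rightarrow> complex ^ 'n ^ 'n \<Rightarrow> complex ^ 'n ^ 'n \<Rightarrow> real" where
  "sandwiched_renyi \<alpha> \<rho> \<sigma> =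
     (let S = mat_powr \<sigma> ((1 - \<alpha>) / (2 * \<alpha>))
      in 1 / (\<alpha> - 1) * ln (Re (trace (mat_powr (S ** \<rho> ** S) \<alpha>))))"

definition partial :: "'l \<Rightarrow> (real ^ 'l \<Rightarrow> real) \<Rightarrow> real ^ 'l \<Rightarrow> real" where
  "partial i f x = deriv (\<lambda>t. f (x + t *\<^sub>R axis i 1)) 0"

definition renyi_hessian ::
    "(real ^ 'l \<Rightarrow> complex ^ 'n ^ 'n) \<Rightarrow> real \<Rightarrow> real ^ 'l \<Rightarrow> real ^ 'l ^ 'l" where
  "renyi_hessian \<rho> \<alpha> \<theta> =
     (\<chi> i j. 1 / \<alpha> * partial i (partial j (\<lambda>\<epsilon>. sandwiched_renyi \<alpha> (\<rho> \<theta>) (\<rho> (\<theta> + \<epsilon>)))) 0)"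

text \<open>The relative entropy is undefined at \<open>\<alpha> = 1\<close>; the information matrix is a limit there.\<close>

definition sandwiched_info ::
    "(real ^ 'l \<Rightarrow> complex ^ 'n ^ 'n) \<Rightarrow> real \<Rightarrow> real ^ 'l \<Rightarrow> real ^ 'l ^ 'l" where
  "sandwiched_info \<rho> \<alpha> \<theta> =
     (if \<alpha> = 1 then Lim (at 1) (\<lambda>\<beta>. renyi_hessian \<rho> \<beta> \<theta>) else renyi_hessian \<rho> \<alpha> \<theta>)"

text \<open>Twice Frechet differentiable; continuity of the second derivative is not required.\<close>

definition twice_differentiable :: "('a::real_normed_vector \<Rightarrow> 'b::real_normed_vector) \<Rightarrow> bool" where
  "twice_differentiable f \<longleftrightarrow>
     (\<exists>f' :: 'a \<Rightarrow> 'a \<Rightarrow>\<^sub>L 'b.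
        (\<forall>x. (f has_derivative blinfun_apply (f' x)) (at x)) \<and> (\<forall>x. f' differentiable (at x)))"

definition loewner_le :: "real ^ 'l ^ 'l \<Rightarrow> real ^ 'l ^ 'l \<Rightarrow> bool" where
  "loewner_le A B \<longleftrightarrow> transpose (B - A) = B - A \<and> (\<forall>v. 0 \<le> v \<bullet> ((B - A) *v v))"

end

theory Submission
  imports Defs
begin

text \<open>
  Put \<open>r = (1 - \<alpha>) / \<alpha>\<close>. The derivative of \<open>f(A)\<close> along a curve of Hermitian matrices multiplies the entries of
  \<open>A'\<close>, in an eigenbasis of \<open>A\<close>, by the divided differences of \<open>f\<close>. Since \<open>Tr(\<sigma>\<^bsup>1-r\<^esup> D(\<sigma>\<^sup>r)[K]) = r Tr K = 0\<close>
  for traceless \<open>K\<close>, the first derivative of the divergence at \<open>\<sigma>\<close> in direction \<open>K\<close> can be written as a multiple of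
  \<open>Tr(Z(\<sigma>) D(\<sigma>\<^sup>r)[K])\<close> with \<open>Z(\<rho>) = 0\<close>. The second derivative at \<open>\<sigma> = \<rho>\<close> is therefore
  \<open>Tr(Z'(\<rho>)[H] D(\<rho>\<^sup>r)[K])\<close>, and neither second derivatives of matrix functions nor those of the family are needed.
  With \<open>b = 1/\<alpha>\<close> and the eigenvalues \<open>\<lambda>\<close> of \<open>\<rho>\<close> this becomes
  \<open>\<Sum> c(\<lambda>\<^sub>k, \<lambda>\<^sub>l) H\<^sub>k\<^sub>l K\<^sub>l\<^sub>k\<close> with \<open>c(x, y) = b / (b - 1) * (x\<^bsup>b-1\<^esup> - y\<^bsup>b-1\<^esup>) / (x\<^sup>b - y\<^sup>b)\<close>,
  the ratio of the integrals of \<open>u\<^bsup>b-2\<^esup>\<close> and \<open>u\<^bsup>b-1\<^esup>\<close> over \<open>[y, x]\<close>, which decreases in \<open>b\<close>.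
\<close>

subsection \<open>The spectral theorem\<close>

lemma cadj_cadj [simp]: "cadj (cadj A) = A"
  by (simp add: cadj_def vec_eq_iff)

lemma cadj_nth [simp]: "cadj A $ i $ j = cnj (A $ j $ i)"
  by (simp add: cadj_def)

lemma cadj_mult: "cadj (A ** B) = cadj B ** cadj A"
  by (simp add: cadj_def vec_eq_iff matrix_matrix_mult_def mult.commute)

lemma cadj_real_diag [simp]: "cadj (real_diag d) = real_diag d"
  by (auto simp: cadj_def vec_eq_iff real_diag_def)

lemma real_diag_nth: "real_diag d $ i $ j = (if i = j then complex_of_real (d i) else 0)"
  by (simp add: real_diag_def)

lemma real_diag_mult_left: "(real_diag d ** M) $ i $ j = complex_of_real (d i) * M $ i $ j"
  by (simp add: matrix_matrix_mult_def real_diag_def if_distrib [of "\<lambda>x. x * _"] cong: if_cong)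

lemma real_diag_mult_right: "(M ** real_diag d) $ i $ j = M $ i $ j * complex_of_real (d j)"
  by (simp add: matrix_matrix_mult_def real_diag_def if_distrib [of "\<lambda>x. _ * x"] cong: if_cong)

lemma cdot_adjoint: "cdot v (A *v w) = cdot (cadj A *v v) w"
proof -
  have "cdot v (A *v w) = (\<Sum>i\<in>UNIV. \<Sum>j\<in>UNIV. cnj (v $ i) * A $ i $ j * w $ j)"
    by (simp add: cdot_def matrix_vector_mult_def sum_distrib_left mult.assoc)
  also have "\<dots> = (\<Sum>j\<in>UNIV. \<Sum>i\<in>UNIV. cnj (v $ i) * A $ i $ j * w $ j)"
    by (rule sum.swap)
  also have "\<dots> = cdot (cadj A *v v) w"
    by (simp add: cdot_def matrix_vector_mult_def sum_distrib_left mult_ac)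
  finally show ?thesis .
qed

lemma cnj_cdot: "cnj (cdot v w) = cdot w v"
  by (simp add: cdot_def mult.commute)

lemma Re_cdot: "Re (cdot v w) = v \<bullet> w"
  by (simp add: cdot_def inner_vec_def inner_complex_def)

lemma cdot_self: "cdot v v = complex_of_real (v \<bullet> v)"
  by (metis Re_cdot cnj_cdot complex_is_Real_iff of_real_Re Reals_cnj_iff)

lemma cdot_add_right: "cdot v (w + w') = cdot v w + cdot v w'"
  and cdot_scaleR_right: "cdot v (c *\<^sub>R w) = c *\<^sub>R cdot v w"
  by (simp_all add: cdot_def algebra_simps sum.distrib sum_distrib_left scaleR_sum_right)

lemma cmatrix_vector_scaleR: "(A :: complex ^ 'n ^ 'm) *v (c *\<^sub>R v) = c *\<^sub>R (A *v v)"
  by (simp add: matrix_vector_mult_def vec_eq_iff scaleR_sum_right)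

lemma inner_hermitian:
  assumes "cadj A = A"
  shows "v \<bullet> (A *v w) = (A *v v) \<bullet> w"
  by (metis Re_cdot assms cdot_adjoint)

lemma continuous_on_matrix_vector [continuous_intros]:
  fixes A :: "complex ^ 'n ^ 'm"
  shows "continuous_on S (\<lambda>v. A *v v)"
  unfolding matrix_vector_mult_def by (intro continuous_intros)

text \<open>The maximiser of the Rayleigh quotient on an invariant subspace is an eigenvector.\<close>

lemma hermitian_eigenvector:
  fixes A :: "complex ^ 'n ^ 'n"
  assumes A: "cadj A = A"
    and W: "closed W" "\<And>v w. v \<in> W \<Longrightarrow> w \<in> W \<Longrightarrow> v + w \<in> W" "\<And>c v. v \<in> W \<Longrightarrow> c *\<^sub>R v \<in> W"
    and inv: "\<And>v. v \<in> W \<Longrightarrow> A *v v \<in> W"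
    and nz: "u \<in> W" "u \<noteq> 0"
  obtains v m where "v \<in> W" "norm v = 1" "A *v v = m *\<^sub>R v"
proof -
  let ?q = "\<lambda>v. v \<bullet> (A *v v)"
  let ?S = "W \<inter> sphere 0 1"
  have "compact ?S" using W(1) by (simp add: closed_Int_compact)
  moreover have "(1 / norm u) *\<^sub>R u \<in> ?S" using nz W(3) by simp
  moreover have "continuous_on ?S ?q" by (intro continuous_intros)
  ultimately obtain v where v: "v \<in> ?S" "\<And>w. w \<in> ?S \<Longrightarrow> ?q w \<le> ?q v"
    using continuous_attains_sup[of ?S ?q] by blast
  define m where "m = ?q v"
  have bound: "?q w \<le> m * (w \<bullet> w)" if "w \<in> W" for w
  proof (cases "w = 0")
    case False
    have "?q ((1 / norm w) *\<^sub>R w) \<le> m"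
      unfolding m_def using False that W(3) by (intro v) simp
    then show ?thesis
      using False by (simp add: cmatrix_vector_scaleR field_simps dot_square_norm power2_eq_square)
  qed simp
  \<comment> \<open>The residual of the eigenvalue equation serves as direction of variation. It
    lies in \<open>W\<close>, so \<open>bound\<close> applies to \<open>v + t *\<^sub>R b\<close>
    for every \<open>t\<close>; the linear coefficient of the resulting inequality in
    \<open>t\<close> is \<open>2 * (b \<bullet> b)\<close>, which forces
    \<open>b = 0\<close>.\<close>
  define b where "b = m *\<^sub>R v - A *v v"
  have vW: "v \<in> W" and nv: "norm v = 1" using v by auto
  have bW: "b \<in> W"
    unfolding b_def using W(2)[OF W(3)[OF vW, of m] W(3)[OF inv[OF vW], of "-1"]] by simp
  define C where "C = m * (b \<bullet> b) - ?q b"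
  have "0 \<le> 2 * t * (b \<bullet> b) + t\<^sup>2 * C" for t
  proof -
    have le: "?q (v + t *\<^sub>R b) \<le> m * ((v + t *\<^sub>R b) \<bullet> (v + t *\<^sub>R b))"
      by (intro bound W(2) W(3) vW bW)
    have 1: "?q (v + t *\<^sub>R b) = m + 2 * t * (b \<bullet> (A *v v)) + t\<^sup>2 * ?q b"
      using inner_hermitian[OF A, of v b]
      by (simp add: m_def matrix_vector_right_distrib cmatrix_vector_scaleR inner_simps
          power2_eq_square inner_commute distrib_left)
    have "v \<bullet> v = 1" using nv by (simp add: dot_square_norm)
    then have 2: "(v + t *\<^sub>R b) \<bullet> (v + t *\<^sub>R b) = 1 + 2 * t * (b \<bullet> v) + t\<^sup>2 * (b \<bullet> b)"
      by (simp add: inner_simps power2_eq_square inner_commute distrib_left)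
    have 3: "b \<bullet> (A *v v) = m * (b \<bullet> v) - b \<bullet> b"
      by (subst (3) b_def) (simp add: inner_simps)
    show ?thesis
      using le unfolding 1 2 3 C_def by (simp add: algebra_simps)
  qed
  then have *: "0 \<le> 2 * t * (b \<bullet> b) + t\<^sup>2 * C" for t .
  have "b \<bullet> b \<le> 0"
  proof (rule ccontr)
    assume "\<not> b \<bullet> b \<le> 0"
    then have pos: "b \<bullet> b > 0" by (metis not_le)
    \<comment> \<open>A negative \<open>t\<close> so small that
      \<open>t * C \<ge> - (b \<bullet> b)\<close>; then \<open>2 * (b \<bullet> b) + t * C\<close>
      is at least \<open>b \<bullet> b > 0\<close>, while the inequality at \<open>t\<close> makes
      it nonpositive.\<close>
    define t where "t = - (b \<bullet> b) / (\<bar>C\<bar> + 1)"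
    have t: "t < 0" using pos by (simp add: t_def divide_neg_pos)
    have "2 * (b \<bullet> b) + t * C \<le> 0"
    proof -
      have "0 \<le> t * (2 * (b \<bullet> b) + t * C)" using *[of t] by (simp add: algebra_simps power2_eq_square)
      then show ?thesis using t by (simp add: zero_le_mult_iff)
    qed
    moreover have "t * C \<ge> - (b \<bullet> b)"
    proof -
      have "(b \<bullet> b) * C \<le> (b \<bullet> b) * (\<bar>C\<bar> + 1)" using pos by (intro mult_left_mono) auto
      then show ?thesis by (simp add: t_def field_simps)
    qed
    ultimately show False using pos by linarith
  qed
  then have "b = 0" by (metis inner_ge_zero inner_eq_zero_iff order_antisym)
  then have "A *v v = m *\<^sub>R v" by (simp add: b_def)
  with vW nv show ?thesis by (rule that)
qed

text \<open>Induction over a subset \<open>I\<close> of the index type: the orthogonal complement of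
  the eigenvectors found so far is closed, invariant under \<open>A\<close> and nonzero, so
  \<open>hermitian_eigenvector\<close> supplies the next one. At \<open>I = UNIV\<close> the vectors
  are the columns of \<open>U\<close>.\<close>

lemma spectral_theorem:
  fixes A :: "complex ^ 'n ^ 'n"
  assumes A: "cadj A = A"
  obtains U d where "unitary U" "A = U ** real_diag d ** cadj U"
proof -
  have "\<exists>V d. (\<forall>i\<in>I. \<forall>j\<in>I. cdot (V i) (V j) = (if i = j then 1 else 0)) \<and>
      (\<forall>i\<in>I. A *v V i = (d i :: real) *\<^sub>R V i)" if "finite I" for I :: "'n set"
    using that
  proof (induction I)
    case (insert k I)
    then obtain V d where V: "\<forall>i\<in>I. \<forall>j\<in>I. cdot (V i) (V j) = (if i = j then 1 else 0)"
      and d: "\<forall>i\<in>I. A *v V i = (d i :: real) *\<^sub>R V i" by blast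
    let ?W = "{v. \<forall>i\<in>I. cdot (V i) v = 0}"
    \<comment> \<open>The rows are the conjugates of the vectors found so far, and row
      \<open>k\<close> is zero. So \<open>M\<close> is singular, and a vector of its kernel is a
      nonzero element of the orthogonal complement.\<close>
    define M :: "complex ^ 'n ^ 'n" where "M = (\<chi> i j. if i \<in> I then cnj (V i $ j) else 0)"
    have "det M = 0"
      using insert.hyps(2) by (intro det_zero_row(1)[of k]) (auto simp: M_def row_def vec_eq_iff)
    then have "\<not> (\<exists>B. B ** M = mat 1)"
      using invertible_det_nz invertible_left_inverse by blast
    then obtain u where u: "M *v u = 0" "u \<noteq> 0"
      by (auto simp: matrix_left_invertible_ker)
    have uW: "u \<in> ?W"
    proof clarify
      fix i assume "i \<in> I"
      then have "cdot (V i) u = (M *v u) $ i"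
        by (simp add: cdot_def M_def matrix_vector_mult_def)
      then show "cdot (V i) u = 0" using u by simp
    qed
    have "?W = (\<Inter>i\<in>I. {v. cdot (V i) v = 0})" by auto
    moreover have "closed {v. cdot (V i) v = 0}" for i
      unfolding cdot_def by (intro closed_Collect_eq continuous_intros)
    ultimately have cl: "closed ?W" by auto
    have inv: "A *v v \<in> ?W" if "v \<in> ?W" for v
    proof clarify
      fix i assume i: "i \<in> I"
      have "cdot (V i) (A *v v) = cdot (A *v V i) v" by (simp add: cdot_adjoint A)
      also have "\<dots> = cnj (cdot v (d i *\<^sub>R V i))" using d i by (simp add: cnj_cdot)
      also have "\<dots> = 0" using that i cnj_cdot[of v "V i"] by (simp add: cdot_scaleR_right)
      finally show "cdot (V i) (A *v v) = 0" .
    qed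
    obtain v m where v: "v \<in> ?W" "norm v = 1" "A *v v = m *\<^sub>R v"
      by (rule hermitian_eigenvector[OF A cl _ _ inv uW u(2)])
         (auto simp: cdot_add_right cdot_scaleR_right)
    have "cdot v v = 1" using v(2) by (simp add: cdot_self dot_square_norm)
    moreover have "cdot (V i) v = 0" "cdot v (V i) = 0" if "i \<in> I" for i
      using v(1) that cnj_cdot[of "V i" v] by auto
    ultimately show ?case
      using V d v(3) insert.hyps(2)
      by (intro exI[of _ "V(k := v)"] exI[of _ "d(k := m)"]) auto
  qed simp
  from this[of UNIV] obtain V :: "'n \<Rightarrow> complex ^ 'n" and d :: "'n \<Rightarrow> real"
    where V: "\<And>i j. cdot (V i) (V j) = (if i = j then 1 else 0)"
      and d: "\<And>i. A *v V i = d i *\<^sub>R V i" by auto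
  define U :: "complex ^ 'n ^ 'n" where "U = (\<chi> i j. V j $ i)"
  have 1: "cadj U ** U = mat 1"
    using V by (simp add: vec_eq_iff U_def matrix_matrix_mult_def mat_def cdot_def)
  then have 2: "U ** cadj U = mat 1" by (simp add: matrix_left_right_inverse)
  have "(A ** U) $ i $ j = (U ** real_diag d) $ i $ j" for i j
  proof -
    have "(A ** U) $ i $ j = (A *v V j) $ i"
      by (simp add: matrix_matrix_mult_def matrix_vector_mult_def U_def)
    also have "\<dots> = (U ** real_diag d) $ i $ j"
      by (subst d) (simp add: real_diag_mult_right U_def scaleR_conv_of_real[where 'a=complex] mult.commute)
    finally show ?thesis .
  qed
  then have "A ** U = U ** real_diag d" by (simp add: vec_eq_iff)
  then have "A = U ** real_diag d ** cadj U"
    by (metis 2 matrix_mul_assoc matrix_mul_rid)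
  with 1 2 show ?thesis by (intro that) (simp_all add: unitary_def)
qed

subsection \<open>Divided-difference multipliers\<close>

lemma bounded_bilinear_cmatrix_mult:
  "bounded_bilinear ((**) :: complex ^ 'n ^ 'n \<Rightarrow> complex ^ 'n ^ 'n \<Rightarrow> complex ^ 'n ^ 'n)"
  unfolding bilinear_conv_bounded_bilinear[symmetric] bilinear_def
  by (auto intro!: linearI simp: vec_eq_iff matrix_matrix_mult_def algebra_simps sum.distrib scaleR_sum_right)

interpretation cmatrix_mult: bounded_bilinear
  "(**) :: complex ^ 'n ^ 'n \<Rightarrow> complex ^ 'n ^ 'n \<Rightarrow> complex ^ 'n ^ 'n"
  by (rule bounded_bilinear_cmatrix_mult)

lemma tendsto_cadj [tendsto_intros]:
  "(f \<longlongrightarrow> A) F \<Longrightarrow> ((\<lambda>x. cadj (f x)) \<longlongrightarrow> cadj A) F"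
  unfolding cadj_def by (intro tendsto_intros)

lemma tendsto_real_diag [tendsto_intros]:
  "(\<And>i. ((\<lambda>x. f x i) \<longlongrightarrow> d i) F) \<Longrightarrow> ((\<lambda>x. real_diag (f x)) \<longlongrightarrow> real_diag d) F"
  unfolding real_diag_def by (intro vec_tendstoI) (auto intro!: tendsto_intros)

definition diagonalizes :: "complex ^ 'n ^ 'n \<Rightarrow> ('n \<Rightarrow> real) \<Rightarrow> complex ^ 'n ^ 'n \<Rightarrow> bool" where
  "diagonalizes U d A \<longleftrightarrow> unitary U \<and> A = U ** real_diag d ** cadj U"

lemma unitaryD: "unitary U \<Longrightarrow> cadj U ** U = mat 1" "unitary U \<Longrightarrow> U ** cadj U = mat 1"
  by (auto simp: unitary_def)

lemma unitary_cancel: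
  assumes "unitary U"
  shows "cadj U ** (U ** M) = M" "U ** (cadj U ** M) = M"
    "M ** cadj U ** U = M" "M ** U ** cadj U = M"
  using unitaryD[OF assms] by (metis matrix_mul_assoc matrix_mul_lid matrix_mul_rid)+

lemma diagonalizes_iff:
  "diagonalizes U d A \<longleftrightarrow> unitary U \<and> cadj U ** A ** U = real_diag d"
  unfolding diagonalizes_def
  by (metis matrix_mul_assoc unitary_cancel)

lemma diagonalizes_exists:
  assumes "cadj A = A"
  obtains U d where "diagonalizes U d A"
  using spectral_theorem[OF assms] unfolding diagonalizes_def by metis

lemma diagonalizes_hermitian: "diagonalizes U d A \<Longrightarrow> cadj A = A"
  by (auto simp: diagonalizes_def cadj_mult matrix_mul_assoc)

text \<open>
  The double operator integral \<open>\<Sum> g(\<mu>, \<lambda>) P\<^sub>\<mu> H Q\<^sub>\<lambda>\<close> over the spectral projections of \<open>B\<close> and \<open>A\<close>,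
  in eigenbases \<open>V\<close> of \<open>B\<close> and \<open>U\<close> of \<open>A\<close>.
\<close>

definition schur_mult ::
    "(real \<Rightarrow> real \<Rightarrow> real) \<Rightarrow> complex ^ 'n ^ 'n \<Rightarrow> ('n \<Rightarrow> real) \<Rightarrow> complex ^ 'n ^ 'n \<Rightarrow> ('n \<Rightarrow> real)
      \<Rightarrow> complex ^ 'n ^ 'n \<Rightarrow> complex ^ 'n ^ 'n" where
  "schur_mult g V e U d H =
     V ** (\<chi> k l. complex_of_real (g (e k) (d l)) * (cadj V ** H ** U) $ k $ l) ** cadj U"

definition doi ::
    "(real \<Rightarrow> real \<Rightarrow> real) \<Rightarrow> complex ^ 'n ^ 'n \<Rightarrow> complex ^ 'n ^ 'n
      \<Rightarrow> complex ^ 'n ^ 'n \<Rightarrow> complex ^ 'n ^ 'n" where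
  "doi g B A H = (SOME K. \<exists>V e U d. diagonalizes V e B \<and> diagonalizes U d A \<and> K = schur_mult g V e U d H)"

text \<open>The change of basis \<open>W\<close> between two eigenbases of \<open>B\<close>
  intertwines the two diagonal matrices, so \<open>W $ k $ p\<close> vanishes unless
  \<open>e p = e' k\<close>; likewise for \<open>R\<close> and \<open>A\<close>. In every nonzero
  summand of the transformed matrix the two values of \<open>g\<close> therefore agree, and the
  coefficient can be pulled out.\<close>

lemma schur_mult_unique:
  assumes V: "diagonalizes V e B" and V': "diagonalizes V' e' B"
    and U: "diagonalizes U d A" and U': "diagonalizes U' d' A"
  shows "schur_mult g V e U d H = schur_mult g V' e' U' d' H"
proof -
  define W where "W = cadj V' ** V"
  define R where "R = cadj U ** U'"
  define N where "N = cadj V ** H ** U"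
  have un: "unitary V" "unitary V'" "unitary U" "unitary U'"
    using assms by (auto simp: diagonalizes_def)
  have "W ** real_diag e = real_diag e' ** W"
    using V V' un unfolding diagonalizes_iff W_def by (metis matrix_mul_assoc unitary_cancel)
  then have "(W ** real_diag e) $ k $ p = (real_diag e' ** W) $ k $ p" for k p by simp
  then have "W $ k $ p * (complex_of_real (e p) - complex_of_real (e' k)) = 0" for k p
    by (simp add: real_diag_mult_left real_diag_mult_right algebra_simps)
  then have W0: "W $ k $ p = 0 \<or> e p = e' k" for k p
    by (metis mult_eq_0_iff of_real_eq_iff right_minus_eq)
  have "R ** real_diag d' = real_diag d ** R"
    using U U' un unfolding diagonalizes_iff R_def by (metis matrix_mul_assoc unitary_cancel)
  then have "(R ** real_diag d') $ q $ l = (real_diag d ** R) $ q $ l" for q l by simp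
  then have "R $ q $ l = 0 \<or> d' l = d q" for q l
    by (simp add: real_diag_mult_left real_diag_mult_right mult.commute)
  then have R0: "R $ q $ l = 0 \<or> d q = d' l" for q l by metis
  have N': "cadj V' ** H ** U' = W ** N ** R"
    unfolding W_def N_def R_def using un by (simp add: matrix_mul_assoc unitary_cancel)
  let ?M = "\<chi> k l. complex_of_real (g (e k) (d l)) * N $ k $ l"
  let ?M' = "\<chi> k l. complex_of_real (g (e' k) (d' l)) * (W ** N ** R) $ k $ l"
  have "(W ** ?M ** R) $ k $ l = ?M' $ k $ l" for k l
  proof -
    have "(W ** ?M ** R) $ k $ l =
        (\<Sum>q\<in>UNIV. \<Sum>p\<in>UNIV. W $ k $ p * complex_of_real (g (e p) (d q)) * N $ p $ q * R $ q $ l)"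
      by (simp add: matrix_matrix_mult_def sum_distrib_right mult.assoc)
    also have "\<dots> = (\<Sum>q\<in>UNIV. \<Sum>p\<in>UNIV. complex_of_real (g (e' k) (d' l)) * (W $ k $ p * N $ p $ q * R $ q $ l))"
    proof (intro sum.cong refl)
      fix p q
      show "W $ k $ p * complex_of_real (g (e p) (d q)) * N $ p $ q * R $ q $ l =
          complex_of_real (g (e' k) (d' l)) * (W $ k $ p * N $ p $ q * R $ q $ l)"
        using W0[of k p] R0[of q l] by auto
    qed
    also have "\<dots> = ?M' $ k $ l"
      by (simp add: matrix_matrix_mult_def sum_distrib_left sum_distrib_right mult_ac)
    finally show ?thesis .
  qed
  then have M': "?M' = W ** ?M ** R" by (simp add: vec_eq_iff)
  have VR: "V' ** W = V" "R ** cadj U' = cadj U"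
    unfolding W_def R_def using un by (simp_all add: matrix_mul_assoc unitary_cancel unitaryD)
  have "V' ** ?M' ** cadj U' = (V' ** W) ** ?M ** (R ** cadj U')"
    unfolding M' by (simp only: matrix_mul_assoc)
  then have "V' ** ?M' ** cadj U' = V ** ?M ** cadj U"
    unfolding VR .
  then show ?thesis unfolding schur_mult_def N' N_def by simp
qed

lemma doi_eq:
  assumes "diagonalizes V e B" "diagonalizes U d A"
  shows "doi g B A H = schur_mult g V e U d H"
  unfolding doi_def using assms schur_mult_unique
  by (smt (verit, ccfv_threshold) someI_ex)

text \<open>Presents \<open>f(A)\<close> as a multiplier applied to the identity, so that
  \<open>schur_mult_unique\<close> also yields the uniqueness that the \<open>THE\<close> in
  \<open>mat_fun\<close> demands.\<close>

lemma schur_mult_mat_1: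
  assumes "unitary U"
  shows "schur_mult (\<lambda>x y. f y) U d U d (mat 1) = U ** real_diag (\<lambda>i. f (d i)) ** cadj U"
proof -
  have "cadj U ** mat 1 ** U = mat 1" using unitaryD[OF assms] by simp
  then have "(\<chi> k l. complex_of_real (f (d l)) * (cadj U ** mat 1 ** U) $ k $ l) = real_diag (\<lambda>i. f (d i))"
    by (auto simp: vec_eq_iff real_diag_def mat_def)
  then show ?thesis by (simp add: schur_mult_def)
qed

lemma mat_fun_eq:
  assumes "diagonalizes U d A"
  shows "mat_fun f A = U ** real_diag (\<lambda>i. f (d i)) ** cadj U"
  unfolding mat_fun_def
proof (rule the_equality)
  fix B
  assume "\<exists>U d. unitary U \<and> A = U ** real_diag d ** cadj U \<and> B = U ** real_diag (\<lambda>i. f (d i)) ** cadj U"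
  then obtain V e where V: "diagonalizes V e A" and B: "B = V ** real_diag (\<lambda>i. f (e i)) ** cadj V"
    by (auto simp: diagonalizes_def)
  have "B = schur_mult (\<lambda>x y. f y) V e V e (mat 1)"
    using V by (simp add: B schur_mult_mat_1 diagonalizes_def)
  also have "\<dots> = schur_mult (\<lambda>x y. f y) U d U d (mat 1)"
    by (rule schur_mult_unique[OF V assms V assms])
  also have "\<dots> = U ** real_diag (\<lambda>i. f (d i)) ** cadj U"
    using assms by (simp add: schur_mult_mat_1 diagonalizes_def)
  finally show "B = U ** real_diag (\<lambda>i. f (d i)) ** cadj U" .
qed (use assms in \<open>auto simp: diagonalizes_def\<close>)

lemma diagonalizes_mat_fun:
  assumes "diagonalizes U d A"
  shows "diagonalizes U (\<lambda>i. f (d i)) (mat_fun f A)"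
  using assms mat_fun_eq[OF assms] by (simp add: diagonalizes_def)

lemma doi_scaleR:
  assumes "cadj A = A" "cadj B = B"
  shows "doi g B A (c *\<^sub>R H) = c *\<^sub>R doi g B A H"
proof -
  obtain V e where V: "diagonalizes V e B" using assms diagonalizes_exists by metis
  obtain U d where U: "diagonalizes U d A" using assms diagonalizes_exists by metis
  have "(\<chi> k l. complex_of_real (g (e k) (d l)) * (c *\<^sub>R (cadj V ** H ** U)) $ k $ l) =
     c *\<^sub>R (\<chi> k l. complex_of_real (g (e k) (d l)) * (cadj V ** H ** U) $ k $ l)"
    by (simp add: vec_eq_iff)
  then show ?thesis
    unfolding doi_eq[OF V U] schur_mult_def
    by (simp add: cmatrix_mult.scaleR_left cmatrix_mult.scaleR_right)
qed

text \<open>Let \<open>W = cadj V ** U\<close>. Between the two eigenbases, \<open>B - A\<close> has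
  the entries \<open>(e k - d l) * W $ k $ l\<close> and \<open>f(B) - f(A)\<close> has the entries
  \<open>(f (e k) - f (d l)) * W $ k $ l\<close>. The identity is exact for finite differences,
  which reduces differentiation to continuity of \<open>doi\<close>.\<close>

lemma mat_fun_diff:
  assumes A: "diagonalizes U d A" and B: "diagonalizes V e B"
    and g: "\<And>k l. g (e k) (d l) * (e k - d l) = f (e k) - f (d l)"
  shows "mat_fun f B - mat_fun f A = doi g B A (B - A)"
proof -
  have un: "unitary U" "unitary V" using A B by (auto simp: diagonalizes_def)
  let ?W = "cadj V ** U"
  have diff: "cadj V ** (M - N) ** U = real_diag m ** ?W - ?W ** real_diag n"
    if "diagonalizes V m M" "diagonalizes U n N" for M N m n
  proof -
    have "cadj V ** M = real_diag m ** cadj V" "N ** U = U ** real_diag n"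
      using that un unfolding diagonalizes_iff by (metis matrix_mul_assoc unitary_cancel)+
    then show ?thesis
      by (simp add: cmatrix_mult.diff_left cmatrix_mult.diff_right matrix_mul_assoc) (metis matrix_mul_assoc)
  qed
  have "(real_diag (\<lambda>i. f (e i)) ** ?W - ?W ** real_diag (\<lambda>i. f (d i))) $ k $ l =
      complex_of_real (g (e k) (d l)) * (real_diag e ** ?W - ?W ** real_diag d) $ k $ l" for k l
  proof -
    have "(real_diag (\<lambda>i. f (e i)) ** ?W - ?W ** real_diag (\<lambda>i. f (d i))) $ k $ l =
      complex_of_real (f (e k) - f (d l)) * ?W $ k $ l"
      by (simp add: real_diag_mult_left real_diag_mult_right algebra_simps)
    also have "\<dots> = complex_of_real (g (e k) (d l)) * (real_diag e ** ?W - ?W ** real_diag d) $ k $ l"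
      unfolding g[symmetric] by (simp add: real_diag_mult_left real_diag_mult_right algebra_simps)
    finally show ?thesis .
  qed
  then have "cadj V ** (mat_fun f B - mat_fun f A) ** U =
      (\<chi> k l. complex_of_real (g (e k) (d l)) * (cadj V ** (B - A) ** U) $ k $ l)"
    using diff[OF B A] diff[OF diagonalizes_mat_fun[OF B] diagonalizes_mat_fun[OF A], of f f]
    by (simp add: vec_eq_iff)
  then show ?thesis
    unfolding doi_eq[OF B A] schur_mult_def using un
    by (metis matrix_mul_assoc unitary_cancel)
qed

lemma pos_def_eigenvalues:
  assumes "diagonalizes U d A" "pos_def A"
  shows "d k > 0"
proof -
  let ?v = "U *v axis k 1"
  have un: "unitary U" using assms by (simp add: diagonalizes_def)
  have "cadj U *v ?v = axis k 1"
    using unitaryD[OF un] by (simp add: matrix_vector_mul_assoc)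
  then have "?v \<noteq> 0" by (metis axis_eq_0_iff matrix_vector_mult_0_right zero_neq_one)
  then have "0 < Re (cdot ?v (A *v ?v))" using assms by (simp add: pos_def_def)
  also have "cdot ?v (A *v ?v) = cdot (axis k 1) ((cadj U ** A ** U) *v axis k 1)"
    by (simp add: cdot_adjoint[of _ "cadj U"] matrix_vector_mul_assoc[symmetric])
  also have "\<dots> = complex_of_real (d k)"
    using assms by (simp add: diagonalizes_iff cdot_def axis_def matrix_vector_mult_def
        real_diag_def if_distrib[of cnj] if_distrib[of "\<lambda>x. _ * x"] if_distrib[of "\<lambda>x. x * _"] cong: if_cong)
  finally show ?thesis by simp
qed

section \<open>Continuity of double operator integrals\<close>

lemma compact_unitary: "compact {U :: complex ^ 'n ^ 'n. unitary U}"
proof -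
  have "norm U \<le> CARD('n)" if "unitary U" for U :: "complex ^ 'n ^ 'n"
  proof -
    have "norm (U $ i) = 1" for i
    proof -
      have "complex_of_real ((U $ i) \<bullet> (U $ i)) = cnj ((U ** cadj U) $ i $ i)"
        unfolding cdot_self[symmetric] by (simp add: cdot_def matrix_matrix_mult_def)
      also have "\<dots> = 1" using unitaryD[OF that] by (simp add: mat_def)
      finally have "(U $ i) \<bullet> (U $ i) = 1" using of_real_eq_1_iff by blast
      then show ?thesis by (simp add: norm_eq_sqrt_inner)
    qed
    then show ?thesis
      unfolding norm_vec_def by (intro order_trans[OF L2_set_le_sum]) auto
  qed
  then have "bounded {U :: complex ^ 'n ^ 'n. unitary U}" by (auto simp: bounded_iff)
  moreover have "closed {U :: complex ^ 'n ^ 'n. unitary U}"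
    unfolding closed_sequential_limits
  proof clarify
    fix X :: "nat \<Rightarrow> complex ^ 'n ^ 'n" and U
    assume X: "\<forall>n. X n \<in> {U. unitary U}" "X \<longlonglongrightarrow> U"
    have "(\<lambda>n. cadj (X n) ** X n) \<longlonglongrightarrow> cadj U ** U" "(\<lambda>n. X n ** cadj (X n)) \<longlonglongrightarrow> U ** cadj U"
      using X(2) by (intro cmatrix_mult.tendsto tendsto_cadj; simp)+
    then show "unitary U"
      using X(1) by (auto simp: unitary_def LIMSEQ_const_iff)
  qed
  ultimately show ?thesis by (simp add: compact_eq_bounded_closed)
qed

text \<open>If \<open>X\<close> leaves a neighbourhood of \<open>L\<close> infinitely often, some
  subsequence stays outside of it, and no further subsequence of that one converges to
  \<open>L\<close>.\<close>

lemma LIMSEQ_subsubseq: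
  fixes X :: "nat \<Rightarrow> 'a :: topological_space"
  assumes "\<And>r. strict_mono (r :: nat \<Rightarrow> nat) \<Longrightarrow> \<exists>s. strict_mono (s :: nat \<Rightarrow> nat) \<and> (\<lambda>n. X (r (s n))) \<longlonglongrightarrow> L"
  shows "X \<longlonglongrightarrow> L"
proof (rule topological_tendstoI, rule ccontr)
  fix S assume S: "open S" "L \<in> S" "\<not> (\<forall>\<^sub>F n in sequentially. X n \<in> S)"
  then obtain r :: "nat \<Rightarrow> nat" where r: "strict_mono r" "\<And>n. X (r n) \<notin> S"
    using not_eventually_sequentiallyD[OF S(3)] by blast
  then obtain s where "(\<lambda>n. X (r (s n))) \<longlonglongrightarrow> L" using assms by blast
  then have "\<forall>\<^sub>F n in sequentially. X (r (s n)) \<in> S" using S topological_tendstoD by blast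
  then show False using r by (simp add: eventually_sequentially)
qed

text \<open>The eigenvalues are the diagonal entries of \<open>cadj U ** A ** U\<close>, so they
  converge as soon as the bases and the matrices do. The limit of these real diagonal matrices is
  again real diagonal.\<close>

lemma diagonalizes_limit:
  assumes diag: "\<And>n. diagonalizes (U n) (d n) (A n)" and U: "U \<longlonglongrightarrow> U'" and A: "A \<longlonglongrightarrow> A'"
  obtains d' where "diagonalizes U' d' A'" "\<And>k. (\<lambda>n. d n k) \<longlonglongrightarrow> d' k"
proof -
  have "closed {U :: complex ^ 'n ^ 'n. unitary U}" by (simp add: compact_unitary compact_imp_closed)
  then have un: "unitary U'"
    using diag U unfolding closed_sequential_limits diagonalizes_def by blast
  let ?M = "\<lambda>U A. cadj U ** A ** U"
  have lim: "(\<lambda>n. ?M (U n) (A n)) \<longlonglongrightarrow> ?M U' A'"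
    using U A by (intro cmatrix_mult.tendsto tendsto_cadj; simp)
  have M: "?M (U n) (A n) = real_diag (d n)" for n using diag by (simp add: diagonalizes_iff)
  have d: "(\<lambda>n. d n k) \<longlonglongrightarrow> Re (?M U' A' $ k $ k)" for k
    using tendsto_Re[OF tendsto_vec_nth[OF tendsto_vec_nth[OF lim]], of k k]
    by (simp add: M real_diag_nth)
  then have "(\<lambda>n. ?M (U n) (A n)) \<longlonglongrightarrow> real_diag (\<lambda>k. Re (?M U' A' $ k $ k))"
    unfolding M by (intro tendsto_real_diag)
  then have "?M U' A' = real_diag (\<lambda>k. Re (?M U' A' $ k $ k))"
    using lim LIMSEQ_unique by blast
  then show ?thesis using un d by (intro that) (auto simp: diagonalizes_iff)
qed

text \<open>
  Eigenbases need not depend continuously on the matrix; compactness of the unitary group makes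
  some subsequence of them converge, and the limit does not depend on the chosen basis.
\<close>

lemma LIMSEQ_doi:
  assumes g: "\<And>x y. x > 0 \<Longrightarrow> y > 0 \<Longrightarrow> isCont (\<lambda>(x, y). g x y) (x, y)"
    and pos: "\<And>n. pos_def (A n)" "\<And>n. pos_def (B n)" "pos_def A'" "pos_def B'"
    and lim: "A \<longlonglongrightarrow> A'" "B \<longlonglongrightarrow> B'" "H \<longlonglongrightarrow> H'"
  shows "(\<lambda>n. doi g (B n) (A n) (H n)) \<longlonglongrightarrow> doi g B' A' H'"
proof (rule LIMSEQ_subsubseq)
  fix r :: "nat \<Rightarrow> nat" assume r: "strict_mono r"
  have eig: "\<exists>U d. diagonalizes U d M" if "pos_def M" for M :: "complex ^ 'n ^ 'n"
    using that unfolding pos_def_def by (metis diagonalizes_exists)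
  have "\<exists>U d. \<forall>n. diagonalizes (U n) (d n) (A n)"
    using eig[OF pos(1)] by metis
  then obtain U d where U: "\<And>n. diagonalizes (U n) (d n) (A n)" by blast
  have "\<exists>V e. \<forall>n. diagonalizes (V n) (e n) (B n)"
    using eig[OF pos(2)] by metis
  then obtain V e where V: "\<And>n. diagonalizes (V n) (e n) (B n)" by blast
  have "\<forall>n. (U \<circ> r) n \<in> {U. unitary U}" using U by (simp add: diagonalizes_def)
  then obtain U' s where s: "strict_mono s" "(U \<circ> r \<circ> s) \<longlonglongrightarrow> U'"
    using compact_unitary unfolding compact_def by metis
  have "\<forall>n. (V \<circ> r \<circ> s) n \<in> {U. unitary U}" using V by (simp add: diagonalizes_def)
  then obtain V' t where t: "strict_mono t" "(V \<circ> r \<circ> s \<circ> t) \<longlonglongrightarrow> V'"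
    using compact_unitary unfolding compact_def by metis
  define q where "q = s \<circ> t"
  have q: "strict_mono q" using s t by (simp add: q_def strict_mono_o)
  have rq: "strict_mono (r \<circ> q)" using r q by (simp add: strict_mono_o)
  have Vl: "(\<lambda>n. V (r (q n))) \<longlonglongrightarrow> V'" using t by (simp add: q_def o_def)
  have Ul: "(\<lambda>n. U (r (q n))) \<longlonglongrightarrow> U'"
    using LIMSEQ_subseq_LIMSEQ[OF s(2) t(1)] by (simp add: q_def o_def)
  have Al: "(\<lambda>n. A (r (q n))) \<longlonglongrightarrow> A'" and Bl: "(\<lambda>n. B (r (q n))) \<longlonglongrightarrow> B'"
    and Hl: "(\<lambda>n. H (r (q n))) \<longlonglongrightarrow> H'"
    using lim LIMSEQ_subseq_LIMSEQ[OF _ rq] by (auto simp: o_def)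
  obtain d' where d': "diagonalizes U' d' A'" "\<And>k. (\<lambda>n. d (r (q n)) k) \<longlonglongrightarrow> d' k"
    using diagonalizes_limit[OF U Ul Al] by blast
  obtain e' where e': "diagonalizes V' e' B'" "\<And>k. (\<lambda>n. e (r (q n)) k) \<longlonglongrightarrow> e' k"
    using diagonalizes_limit[OF V Vl Bl] by blast
  have gl: "(\<lambda>n. g (e (r (q n)) k) (d (r (q n)) l)) \<longlonglongrightarrow> g (e' k) (d' l)" for k l
  proof -
    have "isCont (\<lambda>(x, y). g x y) (e' k, d' l)"
      using g pos_def_eigenvalues d' e' pos by blast
    from isCont_tendsto_compose[OF this tendsto_Pair[OF e'(2) d'(2)]] show ?thesis by simp
  qed
  have "(\<lambda>n. schur_mult g (V (r (q n))) (e (r (q n))) (U (r (q n))) (d (r (q n))) (H (r (q n))))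
      \<longlonglongrightarrow> schur_mult g V' e' U' d' H'"
    unfolding schur_mult_def
    by (intro cmatrix_mult.tendsto tendsto_cadj tendsto_vec_lambda tendsto_mult tendsto_of_real
        tendsto_vec_nth gl Vl Ul Hl)
  then have "(\<lambda>n. doi g (B (r (q n))) (A (r (q n))) (H (r (q n)))) \<longlonglongrightarrow> doi g B' A' H'"
    by (simp add: doi_eq[OF V U] doi_eq[OF e'(1) d'(1)])
  then show "\<exists>s. strict_mono s \<and> (\<lambda>n. doi g (B (r (s n))) (A (r (s n))) (H (r (s n)))) \<longlonglongrightarrow> doi g B' A' H'"
    using q by blast
qed

lemma tendsto_doi:
  fixes A B H :: "'a :: first_countable_topology \<Rightarrow> complex ^ 'n ^ 'n"
  assumes g: "\<And>x y. x > 0 \<Longrightarrow> y > 0 \<Longrightarrow> isCont (\<lambda>(x, y). g x y) (x, y)"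
    and pos: "\<And>x. pos_def (A x)" "\<And>x. pos_def (B x)" "pos_def A'" "pos_def B'"
    and lim: "(A \<longlongrightarrow> A') (at x)" "(B \<longlongrightarrow> B') (at x)" "(H \<longlongrightarrow> H') (at x)"
  shows "((\<lambda>x. doi g (B x) (A x) (H x)) \<longlongrightarrow> doi g B' A' H') (at x)"
  unfolding tendsto_at_iff_sequentially o_def
proof clarify
  fix X assume X: "\<forall>i. X i \<in> UNIV - {x}" "X \<longlonglongrightarrow> x"
  show "(\<lambda>n. doi g (B (X n)) (A (X n)) (H (X n))) \<longlonglongrightarrow> doi g B' A' H'"
    using lim X unfolding tendsto_at_iff_sequentially o_def
    by (intro LIMSEQ_doi g pos) auto
qed

section \<open>Derivatives of matrix functions along curves\<close>

lemma has_vector_derivative_iff_quotient: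
  "(f has_vector_derivative D) (at x) \<longleftrightarrow> ((\<lambda>y. (1 / (y - x)) *\<^sub>R (f y - f x)) \<longlongrightarrow> D) (at x)"
proof -
  have "norm (f y - f x - (y - x) *\<^sub>R D) / norm (y - x) = norm ((1 / (y - x)) *\<^sub>R (f y - f x) - D)"
    if "y \<noteq> x" for y
  proof -
    have "(1 / (y - x)) *\<^sub>R (f y - f x) - D = (1 / (y - x)) *\<^sub>R (f y - f x - (y - x) *\<^sub>R D)"
      using that by (simp add: scaleR_diff_right)
    then show ?thesis by simp
  qed
  then have "((\<lambda>y. norm (f y - f x - (y - x) *\<^sub>R D) / norm (y - x)) \<longlongrightarrow> 0) (at x) \<longleftrightarrow>
      ((\<lambda>y. norm ((1 / (y - x)) *\<^sub>R (f y - f x) - D)) \<longlongrightarrow> 0) (at x)"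
    by (intro tendsto_cong) (auto simp: eventually_at_filter)
  then show ?thesis
    unfolding has_vector_derivative_def has_derivative_iff_norm
    by (simp add: bounded_linear_scaleR_left tendsto_norm_zero_iff LIM_zero_iff)
qed

text \<open>The Daletskii-Krein formula. By \<open>mat_fun_diff\<close> and homogeneity of
  \<open>doi\<close>, the difference quotient of \<open>f(A)\<close> is the multiplier for
  \<open>A y\<close> and \<open>A x\<close> applied to the difference quotient of \<open>A\<close>;
  joint continuity of \<open>doi\<close> gives the limit.\<close>

lemma has_vector_derivative_mat_fun:
  assumes g: "\<And>x y. x > 0 \<Longrightarrow> y > 0 \<Longrightarrow> isCont (\<lambda>(x, y). g x y) (x, y)"
    and fg: "\<And>x y. x > 0 \<Longrightarrow> y > 0 \<Longrightarrow> g x y * (x - y) = f x - f y"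
    and pos: "\<And>x. pos_def (A x)"
    and A: "(A has_vector_derivative A') (at x)"
  shows "((\<lambda>x. mat_fun f (A x)) has_vector_derivative doi g (A x) (A x) A') (at x)"
proof -
  have herm: "cadj (A y) = A y" for y using pos by (simp add: pos_def_def)
  have diff: "mat_fun f (A y) - mat_fun f (A x) = doi g (A y) (A x) (A y - A x)" for y
  proof -
    obtain V e where V: "diagonalizes V e (A y)" using herm diagonalizes_exists by metis
    obtain U d where U: "diagonalizes U d (A x)" using herm diagonalizes_exists by metis
    show ?thesis
      by (rule mat_fun_diff[OF U V]) (intro fg pos_def_eigenvalues[OF V pos] pos_def_eigenvalues[OF U pos])
  qed
  have "(A \<longlongrightarrow> A x) (at x)"
    using A has_vector_derivative_continuous isContD by blast
  then show ?thesis
    using A unfolding has_vector_derivative_iff_quotient diff doi_scaleR[OF herm herm, symmetric]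
    by (intro tendsto_doi g pos tendsto_const)
qed

subsection \<open>The coefficient function\<close>

definition powr_dd :: "real \<Rightarrow> real \<Rightarrow> real \<Rightarrow> real" where
  "powr_dd p x y = (if x = y then p * x powr (p - 1) else (x powr p - y powr p) / (x - y))"

lemma powr_dd_mult: "powr_dd p x y * (x - y) = x powr p - y powr p"
  by (simp add: powr_dd_def)

lemma powr_dd_diag [simp]: "powr_dd p x x = p * x powr (p - 1)"
  by (simp add: powr_dd_def)

lemma powr_dd_commute: "powr_dd p x y = powr_dd p y x"
  by (simp add: powr_dd_def divide_simps) (simp add: algebra_simps)

text \<open>Turns the divided difference into a value of the derivative at an intermediate point,
  also on the diagonal. This yields continuity there.\<close>

lemma powr_dd_mean_value:
  assumes "0 < x" "x \<le> y"
  obtains z where "x \<le> z" "z \<le> y" "powr_dd p x y = p * z powr (p - 1)"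
proof (cases "x = y")
  case False
  then obtain z where z: "x < z" "z < y" "y powr p - x powr p = (y - x) * (p * z powr (p - 1))"
    using assms MVT2[of x y "\<lambda>u. u powr p" "\<lambda>u. p * u powr (p - 1)"]
    by (force intro: has_real_derivative_powr)
  then have "powr_dd p x y = p * z powr (p - 1)"
    using False by (simp add: powr_dd_def divide_simps) (simp add: algebra_simps)
  then show ?thesis using z by (intro that[of z]) auto
qed (use that in auto)

lemma isCont_powr_dd:
  assumes "x > 0" "y > 0"
  shows "isCont (\<lambda>(x, y). powr_dd p x y) (x, y)"
proof (cases "x = y")
  case False
  have "isCont (\<lambda>u :: real \<times> real. (fst u powr p - snd u powr p) / (fst u - snd u)) (x, y)"
    using assms False by (intro continuous_intros) auto
  moreover have "open {u :: real \<times> real. fst u \<noteq> snd u}"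
    by (intro open_Collect_neq continuous_intros)
  then have "\<forall>\<^sub>F u in nhds (x, y). fst u \<noteq> snd u"
    using False by (auto simp: eventually_nhds)
  then have "\<forall>\<^sub>F u in nhds (x, y). (\<lambda>(x, y). powr_dd p x y) u = (fst u powr p - snd u powr p) / (fst u - snd u)"
    by eventually_elim (auto simp: powr_dd_def split: prod.splits)
  ultimately show ?thesis by (simp add: isCont_cong)
next
  case True
  have "isCont (\<lambda>u. p * u powr (p - 1)) x" using assms by (intro continuous_intros) auto
  show ?thesis
    unfolding continuous_at_eps_delta
  proof (intro allI impI)
    fix e :: real assume "e > 0"
    with \<open>isCont (\<lambda>u. p * u powr (p - 1)) x\<close> obtain d where d: "d > 0"
      "\<And>u. dist u x < d \<Longrightarrow> dist (p * u powr (p - 1)) (p * x powr (p - 1)) < e"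
      unfolding continuous_at_eps_delta by blast
    \<comment> \<open>The intermediate point \<open>z\<close> lies between \<open>u\<close> and
      \<open>v\<close>, hence within \<open>d\<close> of \<open>x\<close>, where the derivative is
      already controlled.\<close>
    have *: "dist (powr_dd p u v) (powr_dd p x x) < e"
      if uv: "dist u x < d" "dist v x < d" "u > 0" "u \<le> v" for u v
    proof -
      obtain z where z: "u \<le> z" "z \<le> v" "powr_dd p u v = p * z powr (p - 1)"
        using powr_dd_mean_value uv by blast
      then have "dist z x < d" using uv by (auto simp: dist_real_def)
      then show ?thesis using d(2) z(3) by simp
    qed
    show "\<exists>d>0. \<forall>u. dist u (x, y) < d \<longrightarrow>
        dist (case u of (x, y) \<Rightarrow> powr_dd p x y) (case (x, y) of (x, y) \<Rightarrow> powr_dd p x y) < e"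
    \<comment> \<open>The bound \<open>x\<close> on the radius keeps both coordinates positive, as
      the mean value form requires.\<close>
    proof (intro exI[of _ "min d x"] conjI allI impI)
      fix w :: "real \<times> real" assume w: "dist w (x, y) < min d x"
      obtain u v where uv: "w = (u, v)" by fastforce
      have "dist u x < min d x" "dist v x < min d x"
        using w True dist_fst_le[of w "(x, y)"] dist_snd_le[of w "(x, y)"] by (auto simp: uv)
      moreover from this have "u > 0" "v > 0" by (auto simp: dist_real_def)
      ultimately show "dist (case w of (x, y) \<Rightarrow> powr_dd p x y) (case (x, y) of (x, y) \<Rightarrow> powr_dd p x y) < e"
        using *[of u v] *[of v u] by (cases "u \<le> v") (auto simp: uv True powr_dd_commute)
    qed (use d assms in auto)
  qed
qed

text \<open>The values at \<open>x = y\<close> and at \<open>\<alpha> = 1\<close> are the continuous extensions.\<close>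

definition info_kernel :: "real \<Rightarrow> real \<Rightarrow> real \<Rightarrow> real" where
  "info_kernel \<alpha> x y =
     (if x = y then 1 / x
      else if \<alpha> = 1 then (ln x - ln y) / (x - y)
      else 1 / (1 - \<alpha>) * ((x powr (1 / \<alpha> - 1) - y powr (1 / \<alpha> - 1)) / (x powr (1 / \<alpha>) - y powr (1 / \<alpha>))))"

lemma info_kernel_commute: "info_kernel \<alpha> x y = info_kernel \<alpha> y x"
proof -
  have "(a - b) / (c - d) = (b - a) / (d - c)" for a b c d :: real
    by (metis minus_diff_eq minus_divide_divide)
  note this[of "ln x" "ln y" x y] this[of "x powr (1 / \<alpha> - 1)" "y powr (1 / \<alpha> - 1)" "x powr (1 / \<alpha>)" "y powr (1 / \<alpha>)"]
  then show ?thesis unfolding info_kernel_def by auto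
qed

lemma powr_inj_pos:
  fixes x y :: real
  assumes "x > 0" "y > 0" "p \<noteq> 0" "x powr p = y powr p"
  shows "x = y"
  using assms by (metis less_imp_le powr_one powr_powr right_inverse)

text \<open>The bracket ending in \<open>powr_dd (1 - r) x y\<close> is the factor by which the
  derivative of \<open>renyi_grad\<close> at \<open>\<sigma> = \<rho>\<close> multiplies an entry of
  the tangent, for eigenvalues \<open>x\<close> and \<open>y\<close>; \<open>powr_dd r x y\<close>
  comes from the derivative of \<open>\<sigma> powr r\<close>. Off the diagonal,
  \<open>A = x powr s\<close> and \<open>B = y powr s\<close> make every term rational in
  \<open>x\<close>, \<open>y\<close>, \<open>A\<close>, \<open>B\<close>, and a polynomial identity
  remains.\<close>

lemma info_kernel_eq:
  fixes x y \<alpha> s r :: real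
  assumes pos: "x > 0" "y > 0" "\<alpha> > 0" and \<alpha>: "\<alpha> \<noteq> 1"
    and s: "s = (1 - \<alpha>) / (2 * \<alpha>)" and r: "r = (1 - \<alpha>) / \<alpha>"
  shows "1 / (\<alpha> - 1) *
     ((powr_dd (- s) x y * (y * y powr (- s)) + x powr (- s) * x * powr_dd (- s) x y
       + x powr (- s) * (powr_dd \<alpha> (x powr (1 / \<alpha>)) (y powr (1 / \<alpha>))
           * (powr_dd s x y * (y * y powr s) + x powr s * x * powr_dd s x y)) * y powr (- s)
       - powr_dd (1 - r) x y) * powr_dd r x y) = info_kernel \<alpha> x y"
proof (cases "x = y")
  case False
  define A where "A = x powr s"
  define B where "B = y powr s"
  have AB: "A > 0" "B > 0" using pos by (auto simp: A_def B_def)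
  have r2: "r = s + s" and a: "1 / \<alpha> = 1 + r"
    using pos by (auto simp: s r field_simps)
  have xr: "x powr r = A\<^sup>2" "y powr r = B\<^sup>2"
    unfolding A_def B_def r2 powr_add power2_eq_square by auto
  have e: "x powr (- s) = 1 / A" "y powr (- s) = 1 / B" "x powr r = A\<^sup>2" "y powr r = B\<^sup>2"
    "x powr (1 - r) = x / A\<^sup>2" "y powr (1 - r) = y / B\<^sup>2"
    "x powr (1 / \<alpha>) = x * A\<^sup>2" "y powr (1 / \<alpha>) = y * B\<^sup>2"
    unfolding a using pos xr by (simp_all add: A_def B_def powr_minus_divide powr_add powr_diff)
  have inv: "(x powr (1 / \<alpha>)) powr \<alpha> = x" "(y powr (1 / \<alpha>)) powr \<alpha> = y"
    using pos by (simp_all add: powr_powr)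
  have ne: "x * A\<^sup>2 \<noteq> y * B\<^sup>2"
    using False powr_inj_pos[of x y "1 / \<alpha>"] pos unfolding e by auto
  define D where "D = x - y"
  define E where "E = x * A\<^sup>2 - y * B\<^sup>2"
  have DE: "D \<noteq> 0" "E \<noteq> 0" using False ne by (auto simp: D_def E_def)
  have dd\<alpha>: "powr_dd \<alpha> (x powr (1 / \<alpha>)) (y powr (1 / \<alpha>)) = D / E"
    using ne unfolding powr_dd_def inv by (simp add: e D_def E_def)
  have dds: "powr_dd s x y = (A - B) / D" "powr_dd (- s) x y = (1 / A - 1 / B) / D"
      "powr_dd r x y = (A\<^sup>2 - B\<^sup>2) / D" "powr_dd (1 - r) x y = (x / A\<^sup>2 - y / B\<^sup>2) / D"
    using False unfolding powr_dd_def by (simp_all add: e A_def[symmetric] B_def[symmetric] D_def)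
  have frac: "N1 / (D * A\<^sup>2 * B\<^sup>2) + N2 / (E * A * B) - N3 / (D * A\<^sup>2 * B\<^sup>2)
      = (N1 * E + N2 * D * A * B - N3 * E) / (D * E * A\<^sup>2 * B\<^sup>2)" for N1 N2 N3
    using DE AB by (simp add: divide_simps power2_eq_square)
  \<comment> \<open>Over the common denominator \<open>D * E * A^2 * B^2\<close> the numerators of
    the three parts of the bracket add up to this left side. The bracket is thus
    \<open>- (D / E)\<close>.\<close>
  have poly: "- ((A - B) * (x * B + y * A)) * E + (A - B) * (x * A + y * B) * D * A * B
      - (x * B\<^sup>2 - y * A\<^sup>2) * E = - (D\<^sup>2 * A\<^sup>2 * B\<^sup>2)"
    unfolding D_def E_def by (simp add: algebra_simps power2_eq_square)
  have "(1 / A - 1 / B) / D * (y * (1 / B)) + 1 / A * x * ((1 / A - 1 / B) / D)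
      = - ((A - B) * (x * B + y * A)) / (D * A\<^sup>2 * B\<^sup>2)"
    using DE AB by (simp add: divide_simps power2_eq_square) (simp add: algebra_simps)
  moreover have "1 / A * (D / E * ((A - B) / D * (y * B) + A * x * ((A - B) / D))) * (1 / B)
      = (A - B) * (x * A + y * B) / (E * A * B)"
    using DE AB by (simp add: divide_simps) (simp add: algebra_simps)
  moreover have "(x / A\<^sup>2 - y / B\<^sup>2) / D = (x * B\<^sup>2 - y * A\<^sup>2) / (D * A\<^sup>2 * B\<^sup>2)"
    using DE AB by (simp add: divide_simps)
  moreover have "- (D\<^sup>2 * A\<^sup>2 * B\<^sup>2) / (D * E * A\<^sup>2 * B\<^sup>2) = - (D / E)"
    using DE AB by (simp add: power2_eq_square)
  ultimately have "1 / A * (D / E * ((A - B) / D * (y * B) + A * x * ((A - B) / D))) * (1 / B)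
      + ((1 / A - 1 / B) / D * (y * (1 / B)) + 1 / A * x * ((1 / A - 1 / B) / D))
      - (x / A\<^sup>2 - y / B\<^sup>2) / D = - (D / E)"
    using frac[of "- ((A - B) * (x * B + y * A))" "(A - B) * (x * A + y * B)" "x * B\<^sup>2 - y * A\<^sup>2", unfolded poly]
    by (simp only: add.commute)
  then have *: "powr_dd (- s) x y * (y * y powr (- s)) + x powr (- s) * x * powr_dd (- s) x y
       + x powr (- s) * (powr_dd \<alpha> (x powr (1 / \<alpha>)) (y powr (1 / \<alpha>))
           * (powr_dd s x y * (y * y powr s) + x powr s * x * powr_dd s x y)) * y powr (- s)
       - powr_dd (1 - r) x y = - (D / E)"
    unfolding dds dd\<alpha> unfolding e A_def[symmetric] B_def[symmetric]
    by (simp only: add_ac)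
  have **: "info_kernel \<alpha> x y = 1 / (1 - \<alpha>) * ((A\<^sup>2 - B\<^sup>2) / E)"
  proof -
    have "1 / \<alpha> - 1 = r" using a by simp
    then show ?thesis using False \<alpha> by (simp add: info_kernel_def e E_def)
  qed
  have "1 / (\<alpha> - 1) * (- (D / E) * powr_dd r x y) = 1 / (1 - \<alpha>) * ((A\<^sup>2 - B\<^sup>2) / E)"
    unfolding dds using DE \<alpha> by (simp add: divide_simps) (simp add: algebra_simps)
  then show ?thesis unfolding * ** .
next
  case True
  define A where "A = y powr s"
  have A: "A > 0" using pos by (auto simp: A_def)
  have r2: "r = s + s" and a: "1 / \<alpha> = 1 + r"
    using pos by (auto simp: s r field_simps)
  have yr: "y powr r = A\<^sup>2"
    unfolding A_def r2 powr_add power2_eq_square by auto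
  have e: "y powr (- s) = 1 / A" "y powr (s - 1) = A / y" "y powr (- s - 1) = 1 / (A * y)"
    "y powr (r - 1) = A\<^sup>2 / y" "y powr (1 - r - 1) = 1 / A\<^sup>2"
    using pos yr by (simp_all add: A_def powr_minus_divide powr_diff)
  have "(y powr (1 / \<alpha>)) powr (\<alpha> - 1) = y powr (- r)"
    using pos by (simp add: powr_powr r diff_divide_distrib)
  also have "\<dots> = 1 / A\<^sup>2"
    using yr by (simp add: powr_minus_divide)
  finally have e2: "(y powr (1 / \<alpha>)) powr (\<alpha> - 1) = 1 / A\<^sup>2" .
  \<comment> \<open>This relation collapses the diagonal case: \<open>- 2 * s + \<alpha> * 2 * s -
    (1 - 2 * s) = 2 * s * \<alpha> - 1 = - \<alpha>\<close>.\<close>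
  have s': "2 * s * \<alpha> = 1 - \<alpha>" using pos by (simp add: s)
  have "powr_dd (- s) y y * (y * y powr (- s)) + y powr (- s) * y * powr_dd (- s) y y
       + y powr (- s) * (powr_dd \<alpha> (y powr (1 / \<alpha>)) (y powr (1 / \<alpha>))
           * (powr_dd s y y * (y * y powr s) + y powr s * y * powr_dd s y y)) * y powr (- s)
       - powr_dd (1 - r) y y = (- 2 * s + \<alpha> * 2 * s - (1 - 2 * s)) / A\<^sup>2"
    unfolding powr_dd_diag unfolding e e2 A_def[symmetric] unfolding r2 using A pos
    by (simp add: field_simps power2_eq_square)
  also have "- 2 * s + \<alpha> * 2 * s - (1 - 2 * s) = - \<alpha>" using s' by (simp add: algebra_simps)
  finally have *: "powr_dd (- s) y y * (y * y powr (- s)) + y powr (- s) * y * powr_dd (- s) y y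
       + y powr (- s) * (powr_dd \<alpha> (y powr (1 / \<alpha>)) (y powr (1 / \<alpha>))
           * (powr_dd s y y * (y * y powr s) + y powr s * y * powr_dd s y y)) * y powr (- s)
       - powr_dd (1 - r) y y = - \<alpha> / A\<^sup>2" .
  show ?thesis
    unfolding True * unfolding powr_dd_diag unfolding e info_kernel_def using A pos \<alpha> by (simp add: r field_simps)
qed

text \<open>
  \<open>M t z\<close> is the integral of \<open>u powr (t - 1)\<close> over \<open>[y, z]\<close>. Differentiating in the endpoint twice removes both
  integrals and leaves a product with factors \<open>z - w\<close> and \<open>z powr (b - a) - w powr (b - a)\<close>.
\<close>

lemma powr_integral_ratio_antimono:
  fixes a b y z :: real
  assumes yz: "0 < y" "y \<le> z" and ab: "a \<le> b" and nz: "a \<noteq> 0" "b \<noteq> 0" "a \<noteq> 1" "b \<noteq> 1"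
  defines "M \<equiv> \<lambda>t z. (z powr t - y powr t) / t"
  shows "M a z * M (b - 1) z \<le> M (a - 1) z * M b z"
proof -
  have M: "(M t has_real_derivative w powr (t - 1)) (at w)" if "w > 0" "t \<noteq> 0" for t w
    unfolding M_def using that by (auto intro!: derivative_eq_intros)
  define h where "h = (\<lambda>z. M (a - 1) z * M b z - M a z * M (b - 1) z)"
  have "h y \<le> h z"
  proof (rule DERIV_nonneg_imp_nondecreasing[OF yz(2)])
    fix z assume z: "y \<le> z"
    \<comment> \<open>At \<open>w = z\<close> this is the derivative of \<open>h\<close> at
      \<open>z\<close>. The powers stay fixed at \<open>z\<close>, while the endpoint
      \<open>w\<close> of the integrals moves from \<open>y\<close>, where \<open>k\<close>
      vanishes, up to \<open>z\<close>.\<close>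
    define k where "k = (\<lambda>w. z powr (a - 2) * M b w + M (a - 1) w * z powr (b - 1)
      - z powr (a - 1) * M (b - 1) w - M a w * z powr (b - 2))"
    have "k y \<le> k z"
    proof (rule DERIV_nonneg_imp_nondecreasing[OF z])
      fix w assume w: "y \<le> w" "w \<le> z"
      then have pos: "w > 0" "z > 0" using yz by auto
      define D where "D = z powr (a - 2) * w powr (b - 1) + w powr (a - 2) * z powr (b - 1)
         - z powr (a - 1) * w powr (b - 2) - w powr (a - 1) * z powr (b - 2)"
      have "(k has_real_derivative D) (at w)"
        unfolding k_def D_def using pos nz
        by (auto intro!: derivative_eq_intros M[THEN DERIV_cong] simp: algebra_simps)
      moreover have "D \<ge> 0"
      proof -
        have shift: "u powr (t - 1) = u * u powr (t - 2)" if "u > 0" for u t :: real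
          using that powr_add[of u 1 "t - 2"] by simp
        have "D = (z - w) * (w powr (a - 2) * z powr (b - 2) - z powr (a - 2) * w powr (b - 2))"
          using pos by (simp add: D_def shift algebra_simps)
        moreover have "z powr (a - 2) * w powr (b - 2) \<le> w powr (a - 2) * z powr (b - 2)"
        proof -
          have split: "u powr (b - 2) = u powr (a - 2) * u powr (b - a)" for u :: real
            by (simp add: powr_add[symmetric])
          have "w powr (b - a) \<le> z powr (b - a)" using w pos ab by (intro powr_mono2) auto
          then have "z powr (a - 2) * w powr (a - 2) * w powr (b - a)
              \<le> z powr (a - 2) * w powr (a - 2) * z powr (b - a)"
            by (intro mult_left_mono) auto
          then show ?thesis unfolding split by (simp add: mult_ac)
        qed
        ultimately show ?thesis using w by simp
      qed
      ultimately show "\<exists>D. (k has_real_derivative D) (at w) \<and> 0 \<le> D" by blast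
    qed
    moreover have "k y = 0" by (simp add: k_def M_def)
    moreover have "(h has_real_derivative k z) (at z)"
      unfolding h_def k_def using z yz nz
      by (auto intro!: derivative_eq_intros M[THEN DERIV_cong] simp: algebra_simps)
    ultimately show "\<exists>D. (h has_real_derivative D) (at z) \<and> 0 \<le> D" by auto
  qed
  then show ?thesis by (simp add: h_def M_def)
qed

lemma divide_le_divide_crossI: "0 < b \<Longrightarrow> 0 < d \<Longrightarrow> d * a \<le> c * b \<Longrightarrow> a / b \<le> c / d" for a b c d :: real
  by (simp add: divide_simps mult_ac)

text \<open>The kernel at \<open>\<gamma>\<close> is
  \<open>?M (1 / \<gamma> - 1) / ?M (1 / \<gamma>)\<close>, with positive denominator. Since
  \<open>1 / \<beta> \<le> 1 / \<alpha>\<close>, the claim is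
  \<open>powr_integral_ratio_antimono\<close> with \<open>a = 1 / \<beta>\<close> and
  \<open>b = 1 / \<alpha>\<close>, divided crosswise.\<close>

lemma info_kernel_mono_less:
  assumes xy: "0 < y" "y < x" and \<alpha>: "0 < \<alpha>" "\<alpha> \<le> \<beta>" "\<alpha> \<noteq> 1" "\<beta> \<noteq> 1"
  shows "info_kernel \<alpha> x y \<le> info_kernel \<beta> x y"
proof -
  let ?M = "\<lambda>t. (x powr t - y powr t) / t"
  have pos: "?M t > 0" if "t > 0" for t
    using that xy powr_less_mono2[of t y x] by simp
  have eq: "info_kernel \<gamma> x y = ?M (1 / \<gamma> - 1) / ?M (1 / \<gamma>)" if "\<gamma> > 0" "\<gamma> \<noteq> 1" for \<gamma>
  proof -
    have "1 / \<gamma> - 1 = (1 - \<gamma>) / \<gamma>" using that by (simp add: diff_divide_distrib)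
    then show ?thesis using that xy by (simp add: info_kernel_def)
  qed
  have "?M (1 / \<beta>) * ?M (1 / \<alpha> - 1) \<le> ?M (1 / \<beta> - 1) * ?M (1 / \<alpha>)"
    using assms by (intro powr_integral_ratio_antimono) (auto simp: divide_simps)
  then have "?M (1 / \<alpha> - 1) / ?M (1 / \<alpha>) \<le> ?M (1 / \<beta> - 1) / ?M (1 / \<beta>)"
    using \<alpha> pos[of "1 / \<alpha>"] pos[of "1 / \<beta>"]
    by (intro divide_le_divide_crossI) auto
  moreover have "\<beta> > 0" using \<alpha> by simp
  ultimately show ?thesis using eq[OF \<alpha>(1,3)] eq[OF _ \<alpha>(4)] by simp
qed

text \<open>With \<open>h = 1 / \<alpha> - 1\<close>, the quotient
  \<open>(x powr h - y powr h) / h\<close> tends to the derivative of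
  \<open>x powr u - y powr u\<close> at \<open>u = 0\<close>, which is \<open>ln x - ln y\<close>.
  The limit is the Kubo-Mori kernel.\<close>

lemma tendsto_info_kernel_1:
  assumes pos: "x > 0" "y > 0"
  shows "((\<lambda>\<alpha>. info_kernel \<alpha> x y) \<longlongrightarrow> info_kernel 1 x y) (at 1)"
proof (cases "x = y")
  case False
  let ?h = "\<lambda>\<alpha>::real. 1 / \<alpha> - 1"
  have "((\<lambda>u. x powr u - y powr u) has_real_derivative ln x - ln y) (at 0)"
    using pos by (auto intro!: derivative_eq_intros)
  then have "((\<lambda>h. (x powr h - y powr h) / h) \<longlongrightarrow> ln x - ln y) (at 0)"
    using pos by (simp add: DERIV_def)
  moreover have "filterlim ?h (at 0) (at 1)"
    unfolding filterlim_at by (auto simp: eventually_at_filter intro!: tendsto_eq_intros)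
  ultimately have "((\<lambda>\<alpha>. (x powr ?h \<alpha> - y powr ?h \<alpha>) / ?h \<alpha>) \<longlongrightarrow> ln x - ln y) (at 1)"
    by (rule filterlim_compose)
  then have "((\<lambda>\<alpha>. 1 / \<alpha> * ((x powr ?h \<alpha> - y powr ?h \<alpha>) / ?h \<alpha>) / (x powr (1 / \<alpha>) - y powr (1 / \<alpha>)))
      \<longlongrightarrow> 1 / 1 * (ln x - ln y) / (x powr (1 / 1) - y powr (1 / 1))) (at 1)"
    using pos False by (intro tendsto_intros) auto
  moreover have "\<forall>\<^sub>F \<alpha> in at 1. \<alpha> > (0::real)"
    using order_tendstoD(1)[OF tendsto_ident_at, of 0 "1::real" UNIV] by simp
  then have "\<forall>\<^sub>F \<alpha> in at 1. 1 / \<alpha> * ((x powr ?h \<alpha> - y powr ?h \<alpha>) / ?h \<alpha>) / (x powr (1 / \<alpha>) - y powr (1 / \<alpha>))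
       = info_kernel \<alpha> x y"
    using eventually_neq_at_within[of 1 "1::real" UNIV]
  proof eventually_elim
    case (elim \<alpha>)
    then have "1 / \<alpha> / ?h \<alpha> = 1 / (1 - \<alpha>)" by (simp add: field_simps)
    then show ?case using elim False by (simp add: info_kernel_def)
  qed
  ultimately show ?thesis
    using False pos by (simp add: info_kernel_def tendsto_cong)
qed (simp add: info_kernel_def)

text \<open>Away from the parameter 1 this is the ordered case together with symmetry, and the
  kernel is constant in the parameter when \<open>x = y\<close>. If one parameter is 1, the
  inequality holds for nearby parameters and passes to the limit.\<close>

lemma info_kernel_mono:
  assumes xy: "0 < x" "0 < y" and \<alpha>: "0 < \<alpha>" "\<alpha> \<le> \<beta>"
  shows "info_kernel \<alpha> x y \<le> info_kernel \<beta> x y"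
proof -
  have *: "info_kernel \<alpha> x y \<le> info_kernel \<beta> x y"
    if "\<alpha> \<noteq> 1" "\<beta> \<noteq> 1" "0 < \<alpha>" "\<alpha> \<le> \<beta>" for \<alpha> \<beta>
  proof (cases x y rule: linorder_cases)
    case less
    then show ?thesis
      using info_kernel_mono_less[of x y \<alpha> \<beta>] xy that by (simp add: info_kernel_commute[of _ x y])
  next
    case greater
    then show ?thesis using info_kernel_mono_less[of y x \<alpha> \<beta>] xy that by simp
  qed (simp add: info_kernel_def)
  consider "\<alpha> = \<beta>" | "\<alpha> \<noteq> 1" "\<beta> \<noteq> 1" | "\<alpha> = 1" "1 < \<beta>" | "\<alpha> < 1" "\<beta> = 1"
    using \<alpha> by linarith
  then show ?thesis
  proof cases
    case 3
    have "\<forall>\<^sub>F \<gamma> in at 1. 0 < \<gamma> \<and> \<gamma> < \<beta>"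
      using 3 order_tendstoD[OF tendsto_ident_at[of "1::real" UNIV]] by (intro eventually_conj) auto
    then have "\<forall>\<^sub>F \<gamma> in at 1. info_kernel \<gamma> x y \<le> info_kernel \<beta> x y"
      using eventually_neq_at_within[of 1 "1::real" UNIV]
      by eventually_elim (use 3 in \<open>auto intro!: *\<close>)
    then show ?thesis
      using 3 tendsto_upperbound[OF tendsto_info_kernel_1[OF xy]] by simp
  next
    case 4
    have "\<forall>\<^sub>F \<gamma> in at 1. \<alpha> < \<gamma>"
      using 4 order_tendstoD[OF tendsto_ident_at[of "1::real" UNIV]] by auto
    then have "\<forall>\<^sub>F \<gamma> in at 1. info_kernel \<alpha> x y \<le> info_kernel \<gamma> x y"
      using eventually_neq_at_within[of 1 "1::real" UNIV]
      by eventually_elim (use 4 \<alpha> in \<open>auto intro!: *\<close>)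
    then show ?thesis
      using 4 tendsto_lowerbound[OF tendsto_info_kernel_1[OF xy]] by simp
  qed (use \<alpha> *[of \<alpha> \<beta>] in auto)
qed

subsection \<open>Matrix powers and the first derivative\<close>

lemma real_diag_mult: "real_diag a ** real_diag b = real_diag (\<lambda>i. a i * b i)"
  by (auto simp: vec_eq_iff real_diag_mult_left) (auto simp: real_diag_nth)

lemma trace_unitary_conj: "unitary U \<Longrightarrow> trace (cadj U ** M ** U) = trace M"
  by (metis trace_mul_sym matrix_mul_assoc unitary_cancel(2))

lemma unitary_conj_mult:
  "unitary U \<Longrightarrow> cadj U ** (A ** B) ** U = (cadj U ** A ** U) ** (cadj U ** B ** U)"
  by (simp add: matrix_mul_assoc unitary_cancel)

lemma unitary_conj_add: "cadj U ** (A + B) ** U = cadj U ** A ** U + cadj U ** B ** U"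
  and unitary_conj_diff: "cadj U ** (A - B) ** U = cadj U ** A ** U - cadj U ** B ** U"
  for U :: "complex ^ 'n ^ 'n"
  by (simp_all add: cmatrix_mult.add_left cmatrix_mult.add_right cmatrix_mult.diff_left cmatrix_mult.diff_right)

lemma bounded_linear_Re_trace: "bounded_linear (\<lambda>M :: complex ^ 'n ^ 'n. Re (trace M))"
  unfolding linear_conv_bounded_linear[symmetric]
  by (auto intro!: linearI simp: trace_def sum.distrib sum_distrib_left)

lemma trace_scaleR: "trace (c *\<^sub>R A) = c *\<^sub>R trace (A :: complex ^ 'n ^ 'n)"
  by (simp add: trace_def scaleR_sum_right)

lemma trace_mult_conv_sum: "trace (A ** B) = (\<Sum>k\<in>UNIV. \<Sum>l\<in>UNIV. A $ k $ l * B $ l $ k)"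
  by (simp add: trace_def matrix_matrix_mult_def)

lemma conj_doi:
  assumes "diagonalizes U d A"
  shows "cadj U ** doi g A A H ** U = (\<chi> k l. complex_of_real (g (d k) (d l)) * (cadj U ** H ** U) $ k $ l)"
proof -
  have "unitary U" using assms by (simp add: diagonalizes_def)
  then show ?thesis
    unfolding doi_eq[OF assms assms] schur_mult_def by (simp add: matrix_mul_assoc unitary_cancel unitaryD)
qed

lemma conj_mat_fun:
  assumes "diagonalizes U d A"
  shows "cadj U ** mat_fun f A ** U = real_diag (\<lambda>i. f (d i))"
  using diagonalizes_mat_fun[OF assms] by (simp add: diagonalizes_iff)

lemma trace_mat_fun_mult:
  assumes "diagonalizes U d A"
  shows "trace (mat_fun f A ** H) = (\<Sum>k\<in>UNIV. complex_of_real (f (d k)) * (cadj U ** H ** U) $ k $ k)"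
proof -
  have U: "unitary U" using assms by (simp add: diagonalizes_def)
  have "trace (mat_fun f A ** H) = trace (cadj U ** (mat_fun f A ** H) ** U)"
    by (simp add: trace_unitary_conj U)
  also have "\<dots> = trace (real_diag (\<lambda>i. f (d i)) ** (cadj U ** H ** U))"
    by (simp only: unitary_conj_mult[OF U] conj_mat_fun[OF assms])
  finally show ?thesis by (simp add: trace_def real_diag_mult_left)
qed

text \<open>The trace against a function of \<open>A\<close> sees only the diagonal entries in an
  eigenbasis of \<open>A\<close>, and there the multiplier acts by \<open>g x x\<close>. Under the
  trace, differentiation thus looks as in the commutative case.\<close>

lemma trace_mat_fun_mult_doi:
  assumes "cadj A = A"
  shows "trace (mat_fun f A ** doi g A A H) = trace (mat_fun (\<lambda>x. f x * g x x) A ** H)"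
proof -
  obtain U d where U: "diagonalizes U d A" using assms diagonalizes_exists by metis
  show ?thesis unfolding trace_mat_fun_mult[OF U] conj_doi[OF U] by (simp add: mult.assoc)
qed

lemma mat_fun_cong:
  assumes "pos_def A" "\<And>x. x > 0 \<Longrightarrow> f x = g x"
  shows "mat_fun f A = mat_fun g A"
proof -
  obtain U d where U: "diagonalizes U d A"
    using assms(1) diagonalizes_exists unfolding pos_def_def by metis
  show ?thesis
    unfolding mat_fun_eq[OF U] using pos_def_eigenvalues[OF U assms(1)] assms(2) by simp
qed

lemma mat_fun_const:
  fixes A :: "complex ^ 'n ^ 'n"
  assumes "cadj A = A"
  shows "mat_fun (\<lambda>x. c) A = c *\<^sub>R mat 1"
proof -
  obtain U d where U: "diagonalizes U d A" using assms diagonalizes_exists by metis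
  have "real_diag (\<lambda>i. c) = c *\<^sub>R (mat 1 :: complex ^ 'n ^ 'n)"
    by (auto simp: vec_eq_iff real_diag_def mat_def scaleR_conv_of_real[where 'a=complex])
  moreover have "U ** cadj U = mat 1" using U unitaryD(2) unfolding diagonalizes_def by blast
  ultimately show ?thesis
    unfolding mat_fun_eq[OF U] by (simp add: cmatrix_mult.scaleR_left cmatrix_mult.scaleR_right)
qed

lemma mat_fun_mult:
  assumes "cadj A = A"
  shows "mat_fun f A ** mat_fun g A = mat_fun (\<lambda>x. f x * g x) A"
proof -
  obtain U d where U: "diagonalizes U d A" using assms diagonalizes_exists by metis
  have un: "unitary U" using U by (simp add: diagonalizes_def)
  have "U ** M ** cadj U ** (U ** N ** cadj U) = U ** (M ** N) ** cadj U" for M N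
    using un by (simp add: matrix_mul_assoc unitary_cancel)
  then show ?thesis
    unfolding mat_fun_eq[OF U] by (simp add: real_diag_mult)
qed

section \<open>Real powers of positive definite matrices\<close>

lemma pos_def_hermitian: "pos_def A \<Longrightarrow> cadj A = A"
  by (simp add: pos_def_def)

lemma mat_powr_add: "pos_def A \<Longrightarrow> mat_powr A p ** mat_powr A q = mat_powr A (p + q)"
  unfolding mat_powr_def by (simp add: mat_fun_mult pos_def_hermitian powr_add)

lemma mat_powr_0: "pos_def A \<Longrightarrow> mat_powr A 0 = mat 1"
  unfolding mat_powr_def using mat_fun_cong[of A "\<lambda>x. x powr 0" "\<lambda>x. 1"]
  by (simp add: mat_fun_const pos_def_hermitian)

lemma mat_powr_1:
  assumes "pos_def A"
  shows "mat_powr A 1 = A"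
proof -
  obtain U d where U: "diagonalizes U d A"
    using assms diagonalizes_exists unfolding pos_def_def by metis
  have "mat_powr A 1 = mat_fun (\<lambda>x. x) A"
    unfolding mat_powr_def by (rule mat_fun_cong[OF assms]) simp
  then show ?thesis using U mat_fun_eq[OF U, of "\<lambda>x. x"] by (simp add: diagonalizes_def)
qed

lemma mat_powr_hermitian: "pos_def A \<Longrightarrow> cadj (mat_powr A p) = mat_powr A p"
  unfolding mat_powr_def pos_def_def by (metis diagonalizes_exists diagonalizes_hermitian diagonalizes_mat_fun)

lemma mat_powr_inverse:
  assumes "pos_def A"
  shows "mat_powr A p ** mat_powr A (- p) = mat 1" "mat_powr A (- p) ** mat_powr A p = mat 1"
  using assms by (simp_all add: mat_powr_add mat_powr_0)

lemma has_vector_derivative_mat_powr: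
  assumes "\<And>x. pos_def (A x)" "(A has_vector_derivative A') (at x)"
  shows "((\<lambda>x. mat_powr (A x) p) has_vector_derivative doi (powr_dd p) (A x) (A x) A') (at x)"
  unfolding mat_powr_def
  by (intro has_vector_derivative_mat_fun isCont_powr_dd powr_dd_mult assms)

text \<open>The trace is a sum of powers of positive eigenvalues. Positivity makes the logarithm in
  the divergence differentiable.\<close>

lemma trace_mat_powr_pos:
  assumes "pos_def A"
  shows "Re (trace (mat_powr A p)) > 0"
proof -
  obtain U d where U: "diagonalizes U d A"
    using assms diagonalizes_exists unfolding pos_def_def by metis
  have "unitary U" using U by (simp add: diagonalizes_def)
  then have "cadj U ** mat 1 ** U = mat 1" by (simp add: unitaryD)
  moreover have one: "(mat 1 :: complex ^ 'n ^ 'n) $ k $ k = 1" for k by (simp add: mat_def)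
  ultimately have "trace (mat_powr A p ** mat 1) = (\<Sum>k\<in>UNIV. complex_of_real (d k powr p) * mat 1 $ k $ k)"
    unfolding mat_powr_def trace_mat_fun_mult[OF U] by simp
  then have "Re (trace (mat_powr A p)) = (\<Sum>k\<in>UNIV. d k powr p)"
    by (simp add: one)
  also have "\<dots> > 0"
    using pos_def_eigenvalues[OF U assms] by (intro sum_pos) (auto simp: less_imp_neq[THEN not_sym])
  finally show ?thesis .
qed

definition sandwich :: "real \<Rightarrow> complex ^ 'n ^ 'n \<Rightarrow> complex ^ 'n ^ 'n \<Rightarrow> complex ^ 'n ^ 'n" where
  "sandwich \<alpha> \<rho> \<sigma> = mat_powr \<sigma> ((1 - \<alpha>) / (2 * \<alpha>)) ** \<rho> ** mat_powr \<sigma> ((1 - \<alpha>) / (2 * \<alpha>))"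

lemma sandwiched_renyi_eq:
  "sandwiched_renyi \<alpha> \<rho> \<sigma> = 1 / (\<alpha> - 1) * ln (Re (trace (mat_powr (sandwich \<alpha> \<rho> \<sigma>) \<alpha>)))"
  by (simp add: sandwiched_renyi_def sandwich_def Let_def)

lemma pos_def_sandwich:
  assumes "pos_def \<rho>" "pos_def \<sigma>"
  shows "pos_def (sandwich \<alpha> \<rho> \<sigma>)"
proof -
  define s where "s = (1 - \<alpha>) / (2 * \<alpha>)"
  let ?S = "mat_powr \<sigma> s"
  have S: "cadj ?S = ?S" by (rule mat_powr_hermitian[OF assms(2)])
  have "0 < Re (cdot v ((?S ** \<rho> ** ?S) *v v))" if "v \<noteq> 0" for v
  proof -
    have "mat_powr \<sigma> (- s) *v (?S *v v) = v"
      by (simp add: matrix_vector_mul_assoc mat_powr_inverse[OF assms(2)])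
    then have "?S *v v \<noteq> 0" using that by (metis matrix_vector_mult_0_right)
    then have "0 < Re (cdot (?S *v v) (\<rho> *v (?S *v v)))" using assms by (simp add: pos_def_def)
    then show ?thesis
      by (simp add: matrix_vector_mul_assoc[symmetric] cdot_adjoint[of v ?S] S)
  qed
  then show ?thesis
    using assms(1) by (simp add: pos_def_def sandwich_def s_def[symmetric] cadj_mult S matrix_mul_assoc)
qed

text \<open>Used with \<open>X = S ** \<rho> ** S\<close>,
  \<open>P = mat_powr X (\<alpha> - 1)\<close> and \<open>W = mat_powr X \<alpha>\<close>. Cyclicity
  absorbs \<open>\<rho>\<close> into \<open>W\<close>, and \<open>S'\<close> remains only in
  \<open>S ** S' + S' ** S\<close>, the derivative of the square of \<open>S\<close>.\<close>

lemma trace_sandwich_identity: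
  fixes S T \<rho> P W S' :: "complex ^ 'n ^ 'n"
  assumes inv: "S ** T = mat 1" "T ** S = mat 1"
    and W: "P ** (S ** \<rho> ** S) = W" "(S ** \<rho> ** S) ** P = W"
  shows "trace (P ** (S ** \<rho> ** S' + S' ** \<rho> ** S)) = trace (T ** W ** T ** (S ** S' + S' ** S))"
proof -
  have "trace (P ** (S ** \<rho> ** S')) = trace (P ** (S ** \<rho> ** S) ** T ** S')"
    by (metis inv(1) matrix_mul_assoc matrix_mul_rid)
  also have "\<dots> = trace (W ** T ** S')" by (simp add: W)
  also have "\<dots> = trace (S ** T ** W ** T ** S')" by (simp add: inv)
  also have "\<dots> = trace (T ** W ** T ** (S' ** S))"
    by (metis matrix_mul_assoc trace_mul_sym)
  finally have 1: "trace (P ** (S ** \<rho> ** S')) = trace (T ** W ** T ** (S' ** S))" .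
  have "trace (P ** (S' ** \<rho> ** S)) = trace (P ** S' ** T ** (S ** \<rho> ** S))"
    by (metis inv(2) matrix_mul_assoc matrix_mul_rid)
  also have "\<dots> = trace ((S ** \<rho> ** S) ** P ** (S' ** T))"
    by (metis matrix_mul_assoc trace_mul_sym)
  also have "\<dots> = trace (T ** W ** S')"
    by (metis W(2) matrix_mul_assoc trace_mul_sym)
  also have "\<dots> = trace (T ** W ** T ** (S ** S'))"
    by (metis inv(2) matrix_mul_assoc matrix_mul_rid)
  finally show ?thesis
    using 1 by (simp add: cmatrix_mult.add_right trace_add add.commute)
qed

text \<open>
  The first term alone, paired with the derivative of \<open>\<sigma>\<^sup>r\<close>, gives the derivative of the divergence. The second
  term pairs to a multiple of the trace of the tangent vector, that is to \<open>0\<close>; subtracting it makes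
  the difference vanish at \<open>\<sigma> = \<rho>\<close>.
\<close>

definition renyi_grad :: "real \<Rightarrow> complex ^ 'n ^ 'n \<Rightarrow> complex ^ 'n ^ 'n \<Rightarrow> complex ^ 'n ^ 'n" where
  "renyi_grad \<alpha> \<rho> \<sigma> =
     mat_powr \<sigma> (- ((1 - \<alpha>) / (2 * \<alpha>))) ** mat_powr (sandwich \<alpha> \<rho> \<sigma>) \<alpha> ** mat_powr \<sigma> (- ((1 - \<alpha>) / (2 * \<alpha>)))
       - mat_powr \<sigma> (1 - (1 - \<alpha>) / \<alpha>)"

lemma has_vector_derivative_sandwich:
  assumes "\<And>t. pos_def (\<sigma> t)" "(\<sigma> has_vector_derivative K) (at t)" "s = (1 - \<alpha>) / (2 * \<alpha>)"
  shows "((\<lambda>t. sandwich \<alpha> \<rho> (\<sigma> t)) has_vector_derivative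
      mat_powr (\<sigma> t) s ** \<rho> ** doi (powr_dd s) (\<sigma> t) (\<sigma> t) K
      + doi (powr_dd s) (\<sigma> t) (\<sigma> t) K ** \<rho> ** mat_powr (\<sigma> t) s) (at t)"
proof -
  note S = has_vector_derivative_mat_powr[OF assms(1,2), of s]
  from cmatrix_mult.has_vector_derivative[OF cmatrix_mult.has_vector_derivative[OF S has_vector_derivative_const[of \<rho>]] S]
  show ?thesis by (simp add: sandwich_def assms(3) cmatrix_mult.zero_right)
qed

text \<open>The derivative of the trace of \<open>X\<close> to the power \<open>\<alpha>\<close> is
  \<open>\<alpha>\<close> times the trace of \<open>mat_powr X (\<alpha> - 1) ** X'\<close>, which
  \<open>trace_sandwich_identity\<close> rewrites as a pairing with \<open>R'\<close>. The
  subtracted power in \<open>renyi_grad\<close> pairs with \<open>R'\<close> to \<open>r\<close>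
  times the trace of \<open>K\<close>, whose real part is zero because the trace of
  \<open>\<sigma> t\<close> is constant.\<close>

lemma has_derivative_sandwiched_renyi:
  fixes \<sigma> :: "real \<Rightarrow> complex ^ 'n ^ 'n"
  assumes \<rho>: "pos_def \<rho>" and \<sigma>: "\<And>t. pos_def (\<sigma> t)" "\<And>t. trace (\<sigma> t) = 1"
    and K: "(\<sigma> has_vector_derivative K) (at t)"
    and \<alpha>: "\<alpha> > 0"
  shows "((\<lambda>t. sandwiched_renyi \<alpha> \<rho> (\<sigma> t)) has_real_derivative
     1 / (\<alpha> - 1) * (\<alpha> * Re (trace (renyi_grad \<alpha> \<rho> (\<sigma> t) ** doi (powr_dd ((1 - \<alpha>) / \<alpha>)) (\<sigma> t) (\<sigma> t) K))
       / Re (trace (mat_powr (sandwich \<alpha> \<rho> (\<sigma> t)) \<alpha>)))) (at t)"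
proof -
  define s where "s = (1 - \<alpha>) / (2 * \<alpha>)"
  define r where "r = (1 - \<alpha>) / \<alpha>"
  have rs: "r = s + s" using \<alpha> by (simp add: r_def s_def field_simps)
  define S where "S = mat_powr (\<sigma> t) s"
  define T where "T = mat_powr (\<sigma> t) (- s)"
  define S' where "S' = doi (powr_dd s) (\<sigma> t) (\<sigma> t) K"
  define R' where "R' = doi (powr_dd r) (\<sigma> t) (\<sigma> t) K"
  define X where "X = sandwich \<alpha> \<rho> (\<sigma> t)"
  define X' where "X' = S ** \<rho> ** S' + S' ** \<rho> ** S"
  define W where "W = mat_powr X \<alpha>"
  have Xpos: "pos_def X" unfolding X_def by (intro pos_def_sandwich \<rho> \<sigma>)
  note dS = has_vector_derivative_mat_powr[OF \<sigma>(1) K]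
  \<comment> \<open>Both sides are derivatives of the power \<open>r = s + s\<close> of
    \<open>\<sigma>\<close>: one taken directly, the other by the product rule for two powers
    \<open>s\<close>.\<close>
  have "R' = S ** S' + S' ** S"
  proof -
    have "((\<lambda>t. mat_powr (\<sigma> t) r) has_vector_derivative S ** S' + S' ** S) (at t)"
      using cmatrix_mult.has_vector_derivative[OF dS dS, of s s]
      by (simp add: mat_powr_add[OF \<sigma>(1)] rs S_def S'_def)
    then show ?thesis
      using dS[of r] vector_derivative_unique_at unfolding R'_def by blast
  qed
  moreover have "trace (mat_powr X (\<alpha> - 1) ** X') = trace (T ** W ** T ** (S ** S' + S' ** S))"
    unfolding X'_def
  proof (rule trace_sandwich_identity)
    show "S ** T = mat 1" "T ** S = mat 1"
      unfolding S_def T_def by (simp_all add: mat_powr_inverse[OF \<sigma>(1)])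
    have "S ** \<rho> ** S = mat_powr X 1"
      unfolding mat_powr_1[OF Xpos] by (simp add: X_def sandwich_def S_def s_def)
    then show "mat_powr X (\<alpha> - 1) ** (S ** \<rho> ** S) = W" "(S ** \<rho> ** S) ** mat_powr X (\<alpha> - 1) = W"
      by (simp_all add: mat_powr_add[OF Xpos] W_def)
  qed
  moreover have "Re (trace K) = 0"
  proof -
    have "((\<lambda>t. Re (trace (\<sigma> t))) has_vector_derivative Re (trace K)) (at t)"
      by (rule bounded_linear.has_vector_derivative[OF bounded_linear_Re_trace K])
    then show ?thesis
      using vector_derivative_unique_at[OF _ has_vector_derivative_const[of "1::real"]] \<sigma>(2) by simp
  qed
  moreover have "trace (mat_powr (\<sigma> t) (1 - r) ** R') = r *\<^sub>R trace K"
  proof -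
    have "trace (mat_powr (\<sigma> t) (1 - r) ** R')
        = trace (mat_fun (\<lambda>x. x powr (1 - r) * powr_dd r x x) (\<sigma> t) ** K)"
      unfolding R'_def mat_powr_def by (rule trace_mat_fun_mult_doi[OF pos_def_hermitian[OF \<sigma>(1)]])
    \<comment> \<open>On positive eigenvalues
      \<open>x powr (1 - r) * (r * x powr (r - 1)) = r\<close>.\<close>
    also have "mat_fun (\<lambda>x. x powr (1 - r) * powr_dd r x x) (\<sigma> t) = mat_fun (\<lambda>x. r) (\<sigma> t)"
      by (rule mat_fun_cong[OF \<sigma>(1)]) (simp add: mult.left_commute[of _ r] powr_add[symmetric])
    finally show ?thesis
      by (simp add: mat_fun_const pos_def_hermitian \<sigma>(1) cmatrix_mult.scaleR_left trace_scaleR)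
  qed
  moreover have "trace (doi (powr_dd \<alpha>) X X X') = \<alpha> *\<^sub>R trace (mat_powr X (\<alpha> - 1) ** X')"
  proof -
    have "trace (doi (powr_dd \<alpha>) X X X') = trace (mat_fun (\<lambda>x. 1) X ** doi (powr_dd \<alpha>) X X X')"
      by (simp add: mat_fun_const pos_def_hermitian Xpos)
    also have "\<dots> = trace (mat_fun (\<lambda>x. \<alpha> * x powr (\<alpha> - 1)) X ** X')"
      using trace_mat_fun_mult_doi[OF pos_def_hermitian[OF Xpos], of "\<lambda>x. 1" "powr_dd \<alpha>"] by simp
    also have "mat_fun (\<lambda>x. \<alpha> * x powr (\<alpha> - 1)) X = mat_fun (\<lambda>x. \<alpha>) X ** mat_powr X (\<alpha> - 1)"
      by (simp add: mat_fun_mult pos_def_hermitian Xpos mat_powr_def)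
    finally show ?thesis
      by (simp add: mat_fun_const pos_def_hermitian Xpos cmatrix_mult.scaleR_left trace_scaleR)
  qed
  ultimately have eq: "Re (trace (doi (powr_dd \<alpha>) X X X')) = \<alpha> * Re (trace (renyi_grad \<alpha> \<rho> (\<sigma> t) ** R'))"
    by (simp add: renyi_grad_def cmatrix_mult.diff_left trace_sub r_def s_def T_def W_def X_def)
  have dX: "((\<lambda>t. sandwich \<alpha> \<rho> (\<sigma> t)) has_vector_derivative X') (at t)"
    unfolding X'_def S_def S'_def by (intro has_vector_derivative_sandwich \<sigma> K s_def)
  have "((\<lambda>t. Re (trace (mat_powr (sandwich \<alpha> \<rho> (\<sigma> t)) \<alpha>))) has_vector_derivative
      Re (trace (doi (powr_dd \<alpha>) X X X'))) (at t)"
    unfolding X_def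
    by (intro bounded_linear.has_vector_derivative[OF bounded_linear_Re_trace] has_vector_derivative_mat_powr
        pos_def_sandwich \<rho> \<sigma> dX)
  then have dQ: "((\<lambda>t. Re (trace (mat_powr (sandwich \<alpha> \<rho> (\<sigma> t)) \<alpha>))) has_real_derivative
      \<alpha> * Re (trace (renyi_grad \<alpha> \<rho> (\<sigma> t) ** R'))) (at t)"
    by (simp add: has_real_derivative_iff_has_vector_derivative eq)
  have Q: "Re (trace (mat_powr (sandwich \<alpha> \<rho> (\<sigma> t)) \<alpha>)) > 0"
    by (intro trace_mat_powr_pos pos_def_sandwich \<rho> \<sigma>)
  from DERIV_cmult[OF DERIV_chain2[OF DERIV_ln_divide[OF Q] dQ], of "1 / (\<alpha> - 1)"] show ?thesis
    unfolding sandwiched_renyi_eq R'_def r_def by simp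
qed

subsection \<open>The information matrix\<close>

text \<open>At \<open>\<sigma> = \<rho>\<close> all three factors share the eigenbasis, and the
  exponents add up to \<open>s + 1 + s = 1 / \<alpha>\<close>.\<close>

lemma diagonalizes_sandwich_self:
  assumes \<rho>: "pos_def \<rho>" and U: "diagonalizes U d \<rho>" and \<alpha>: "\<alpha> > 0"
  shows "diagonalizes U (\<lambda>i. d i powr (1 / \<alpha>)) (sandwich \<alpha> \<rho> \<rho>)"
proof -
  define s where "s = (1 - \<alpha>) / (2 * \<alpha>)"
  have un: "unitary U" using U by (simp add: diagonalizes_def)
  have "1 / \<alpha> = s + 1 + s" using \<alpha> by (simp add: s_def field_simps)
  then have p: "d k powr (1 / \<alpha>) = d k powr s * d k * d k powr s" for k
    using pos_def_eigenvalues[OF U \<rho>] by (simp only: powr_add) (simp add: less_imp_le)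
  have "cadj U ** sandwich \<alpha> \<rho> \<rho> ** U
      = real_diag (\<lambda>i. d i powr s) ** real_diag d ** real_diag (\<lambda>i. d i powr s)"
    using U unfolding sandwich_def s_def[symmetric] mat_powr_def
    by (simp add: unitary_conj_mult un conj_mat_fun[OF U] diagonalizes_iff)
  also have "\<dots> = real_diag (\<lambda>i. d i powr (1 / \<alpha>))"
    by (simp add: real_diag_mult p)
  finally show ?thesis using un by (simp add: diagonalizes_iff)
qed

lemma mat_powr_sandwich_self:
  assumes \<rho>: "pos_def \<rho>" and \<alpha>: "\<alpha> > 0"
  shows "mat_powr (sandwich \<alpha> \<rho> \<rho>) \<alpha> = \<rho>"
proof -
  obtain U d where U: "diagonalizes U d \<rho>"
    using \<rho> diagonalizes_exists unfolding pos_def_def by metis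
  have "(d k powr (1 / \<alpha>)) powr \<alpha> = d k" for k
    using pos_def_eigenvalues[OF U \<rho>, of k] \<alpha> by (simp add: powr_powr)
  then show ?thesis
    unfolding mat_powr_def mat_fun_eq[OF diagonalizes_sandwich_self[OF \<rho> U \<alpha>]]
    using U by (simp add: diagonalizes_def)
qed

text \<open>The power \<open>\<alpha>\<close> of the sandwich is \<open>\<rho>\<close> itself, so
  both terms are the same power of \<open>\<rho>\<close>. In the second derivative at this point
  only the derivative of \<open>renyi_grad\<close> survives, not that of the factor it is paired
  with.\<close>

lemma renyi_grad_self:
  assumes "pos_def \<rho>" "\<alpha> > 0"
  shows "renyi_grad \<alpha> \<rho> \<rho> = 0"
proof -
  define s where "s = (1 - \<alpha>) / (2 * \<alpha>)"
  have "mat_powr \<rho> (- s) ** \<rho> ** mat_powr \<rho> (- s) = mat_powr \<rho> (- s + 1 + - s)"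
    by (metis assms(1) mat_powr_1 mat_powr_add)
  also have "- s + 1 + - s = 1 - (1 - \<alpha>) / \<alpha>" using assms by (simp add: s_def field_simps)
  finally show ?thesis
    by (simp add: renyi_grad_def mat_powr_sandwich_self assms s_def)
qed

text \<open>The first argument is frozen at \<open>\<sigma> t\<close> while the second moves. At
  \<open>u = t\<close> all undifferentiated factors are diagonal in the basis \<open>U\<close>, so
  \<open>Z\<close> multiplies each entry of \<open>H\<close> by a number, evaluated by
  \<open>info_kernel_eq\<close>. The factor with swapped indices is the one that the paired matrix
  contributes to the trace.\<close>

lemma has_vector_derivative_renyi_grad:
  fixes \<sigma> :: "real \<Rightarrow> complex ^ 'n ^ 'n"
  assumes \<sigma>: "\<And>t. pos_def (\<sigma> t)" and H: "(\<sigma> has_vector_derivative H) (at t)"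
    and U: "diagonalizes U d (\<sigma> t)" and \<alpha>: "\<alpha> > 0" "\<alpha> \<noteq> 1"
  obtains Z where "((\<lambda>u. renyi_grad \<alpha> (\<sigma> t) (\<sigma> u)) has_vector_derivative Z) (at t)"
    "\<And>k l. complex_of_real (1 / (\<alpha> - 1)) * ((cadj U ** Z ** U) $ k $ l * complex_of_real (powr_dd ((1 - \<alpha>) / \<alpha>) (d l) (d k)))
       = complex_of_real (info_kernel \<alpha> (d k) (d l)) * (cadj U ** H ** U) $ k $ l"
proof -
  define \<rho> where "\<rho> = \<sigma> t"
  define s where "s = (1 - \<alpha>) / (2 * \<alpha>)"
  define r where "r = (1 - \<alpha>) / \<alpha>"
  define p where "p = 1 / \<alpha>"
  define X where "X = sandwich \<alpha> \<rho> \<rho>"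
  define D where "D = (\<lambda>q. doi (powr_dd q) \<rho> \<rho> H)"
  define X' where "X' = mat_powr \<rho> s ** \<rho> ** D s + D s ** \<rho> ** mat_powr \<rho> s"
  define T where "T = mat_powr \<rho> (- s)"
  \<comment> \<open>The product rule for the three factors of \<open>renyi_grad\<close>; the middle
    one, the power \<open>\<alpha>\<close> of \<open>X\<close>, has the value \<open>\<rho>\<close>
    at \<open>u = t\<close>.\<close>
  define Z where "Z = T ** \<rho> ** D (- s) + (T ** doi (powr_dd \<alpha>) X X X' + D (- s) ** \<rho>) ** T - D (1 - r)"
  have un: "unitary U" using U by (simp add: diagonalizes_def)
  have U\<rho>: "diagonalizes U d \<rho>" using U by (simp add: \<rho>_def)
  have pos: "pos_def \<rho>" using \<sigma> by (simp add: \<rho>_def)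
  have UX: "diagonalizes U (\<lambda>i. d i powr p) X"
    unfolding X_def p_def by (rule diagonalizes_sandwich_self[OF pos U\<rho> \<alpha>(1)])
  have X\<alpha>: "mat_powr X \<alpha> = \<rho>" unfolding X_def by (rule mat_powr_sandwich_self[OF pos \<alpha>(1)])
  have dT: "((\<lambda>u. mat_powr (\<sigma> u) q) has_vector_derivative D q) (at t)" for q
    unfolding D_def \<rho>_def by (rule has_vector_derivative_mat_powr[OF \<sigma> H])
  have dX: "((\<lambda>u. sandwich \<alpha> \<rho> (\<sigma> u)) has_vector_derivative X') (at t)"
    unfolding X'_def D_def \<rho>_def by (rule has_vector_derivative_sandwich[OF \<sigma> H s_def])
  have dW: "((\<lambda>u. mat_powr (sandwich \<alpha> \<rho> (\<sigma> u)) \<alpha>) has_vector_derivative doi (powr_dd \<alpha>) X X X') (at t)"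
    using has_vector_derivative_mat_powr[OF pos_def_sandwich[OF pos \<sigma>] dX, of \<alpha>]
    by (simp add: X_def \<rho>_def)
  have "((\<lambda>u. renyi_grad \<alpha> \<rho> (\<sigma> u)) has_vector_derivative Z) (at t)"
    unfolding renyi_grad_def Z_def s_def[symmetric] r_def[symmetric]
    using has_vector_derivative_diff[OF cmatrix_mult.has_vector_derivative[OF
          cmatrix_mult.has_vector_derivative[OF dT[of "- s"] dW] dT[of "- s"]] dT[of "1 - r"]]
    by (simp add: X\<alpha> X_def[symmetric] T_def \<rho>_def[symmetric])
  moreover have "complex_of_real (1 / (\<alpha> - 1)) * ((cadj U ** Z ** U) $ k $ l * complex_of_real (powr_dd r (d l) (d k)))
       = complex_of_real (info_kernel \<alpha> (d k) (d l)) * (cadj U ** H ** U) $ k $ l" for k l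
  proof -
    let ?h = "(cadj U ** H ** U) $ k $ l"
    have conj_\<rho>: "cadj U ** \<rho> ** U = real_diag d" using U\<rho> by (simp add: diagonalizes_iff)
    have conj_powr: "cadj U ** mat_powr \<rho> q ** U = real_diag (\<lambda>i. d i powr q)" for q
      unfolding mat_powr_def by (rule conj_mat_fun[OF U\<rho>])
    have conj_D: "(cadj U ** D q ** U) $ k $ l = complex_of_real (powr_dd q (d k) (d l)) * ?h" for q
      unfolding D_def conj_doi[OF U\<rho>] by simp
    have conj_X': "(cadj U ** X' ** U) $ k $ l = complex_of_real
        (powr_dd s (d k) (d l) * (d l * d l powr s) + d k powr s * d k * powr_dd s (d k) (d l)) * ?h"
      unfolding X'_def unitary_conj_add unitary_conj_mult[OF un] conj_\<rho> conj_powr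
      by (simp add: real_diag_mult_left real_diag_mult_right real_diag_mult conj_D algebra_simps)
    define E where "E = powr_dd (- s) (d k) (d l) * (d l * d l powr (- s)) + d k powr (- s) * d k * powr_dd (- s) (d k) (d l)
       + d k powr (- s) * (powr_dd \<alpha> (d k powr p) (d l powr p)
           * (powr_dd s (d k) (d l) * (d l * d l powr s) + d k powr s * d k * powr_dd s (d k) (d l))) * d l powr (- s)
       - powr_dd (1 - r) (d k) (d l)"
    have "(cadj U ** Z ** U) $ k $ l = complex_of_real E * ?h"
      unfolding Z_def T_def unitary_conj_add unitary_conj_diff unitary_conj_mult[OF un] conj_\<rho> conj_powr
        conj_doi[OF UX] E_def
      by (simp add: real_diag_mult_left real_diag_mult_right real_diag_mult conj_D conj_X' algebra_simps)
    then have "complex_of_real (1 / (\<alpha> - 1)) * ((cadj U ** Z ** U) $ k $ l * complex_of_real (powr_dd r (d l) (d k)))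
       = complex_of_real (1 / (\<alpha> - 1) * (E * powr_dd r (d k) (d l))) * ?h"
      unfolding of_real_mult by (simp only: powr_dd_commute[of r "d l"] mult_ac)
    also have "1 / (\<alpha> - 1) * (E * powr_dd r (d k) (d l)) = info_kernel \<alpha> (d k) (d l)"
      unfolding E_def p_def
      by (rule info_kernel_eq[OF pos_def_eigenvalues[OF U\<rho> pos] pos_def_eigenvalues[OF U\<rho> pos] \<alpha> s_def r_def])
    finally show ?thesis .
  qed
  ultimately show ?thesis unfolding \<rho>_def r_def by (rule that)
qed

lemma Re_of_real_mult: "Re (complex_of_real c * z) = c * Re z"
  by simp

text \<open>The quadratic form of \<open>B - A\<close> at \<open>v\<close> is the sum over
  \<open>p\<close> of \<open>b p - a p\<close> times the squared modulus of the sum of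
  \<open>v $ i * h i p\<close> over \<open>i\<close>.\<close>

lemma loewner_le_kernel:
  fixes h :: "'l :: finite \<Rightarrow> 'p :: finite \<Rightarrow> complex" and A B :: "real ^ 'l ^ 'l"
  assumes A: "\<And>i j. A $ i $ j = (\<Sum>p\<in>UNIV. a p * Re (h i p * cnj (h j p)))"
    and B: "\<And>i j. B $ i $ j = (\<Sum>p\<in>UNIV. b p * Re (h i p * cnj (h j p)))"
    and le: "\<And>p. a p \<le> b p"
  shows "loewner_le A B"
proof -
  have D: "(B - A) $ i $ j = (\<Sum>p\<in>UNIV. (b p - a p) * Re (h i p * cnj (h j p)))" for i j
    by (simp add: A B left_diff_distrib sum_subtractf)
  have "(B - A) $ i $ j = (B - A) $ j $ i" for i j
    unfolding D by (simp add: mult.commute)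
  then have "transpose (B - A) = B - A"
    unfolding vec_eq_iff transpose_def by simp
  moreover have "0 \<le> v \<bullet> ((B - A) *v v)" for v
  proof -
    let ?z = "\<lambda>p. \<Sum>i\<in>UNIV. complex_of_real (v $ i) * h i p"
    have "v \<bullet> ((B - A) *v v)
        = (\<Sum>i\<in>UNIV. \<Sum>j\<in>UNIV. \<Sum>p\<in>UNIV. (b p - a p) * (v $ i * v $ j * Re (h i p * cnj (h j p))))"
      by (simp only: inner_vec_def inner_real_def matrix_vector_mult_def vec_lambda_beta D
          sum_distrib_left sum_distrib_right mult_ac)
    also have "\<dots> = (\<Sum>p\<in>UNIV. (b p - a p) * (\<Sum>i\<in>UNIV. \<Sum>j\<in>UNIV. v $ i * v $ j * Re (h i p * cnj (h j p))))"
    proof -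
      have "(\<Sum>i\<in>UNIV. \<Sum>j\<in>UNIV. \<Sum>p\<in>UNIV. f i j p) = (\<Sum>p\<in>UNIV. \<Sum>i\<in>UNIV. \<Sum>j\<in>UNIV. f i j p)"
        for f :: "'l \<Rightarrow> 'l \<Rightarrow> 'p \<Rightarrow> real"
        using sum.swap[of "\<lambda>i p. \<Sum>j\<in>UNIV. f i j p" UNIV UNIV] sum.swap[of "f _" UNIV UNIV] by simp
      then show ?thesis unfolding sum_distrib_left .
    qed
    also have "\<dots> = (\<Sum>p\<in>UNIV. (b p - a p) * Re (?z p * cnj (?z p)))"
      by (simp add: sum_product Re_sum algebra_simps)
    also have "\<dots> \<ge> 0"
    proof -
      have "0 \<le> Re (z * cnj z)" for z by simp
      then show ?thesis using le by (intro sum_nonneg mult_nonneg_nonneg) (simp_all only: diff_ge_0_iff_ge)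
    qed
    finally show ?thesis .
  qed
  ultimately show ?thesis by (simp add: loewner_le_def)
qed

section \<open>The Hessian in an eigenbasis of the state\<close>

lemma hermitian_vector_derivative:
  assumes "\<And>t. cadj (\<sigma> t) = \<sigma> t" "(\<sigma> has_vector_derivative K) (at t)"
  shows "cadj K = K"
proof -
  let ?q = "\<lambda>u. (1 / (u - t)) *\<^sub>R (\<sigma> u - \<sigma> t)"
  have q: "(?q \<longlongrightarrow> K) (at t)" using assms(2) by (simp add: has_vector_derivative_iff_quotient)
  have "cadj (?q u) = ?q u" for u
  proof -
    have "cnj (\<sigma> u $ j $ i) = \<sigma> u $ i $ j" for u i j
      using assms(1)[of u] by (metis cadj_nth)
    then show ?thesis by (simp add: vec_eq_iff)
  qed
  then have "(?q \<longlongrightarrow> cadj K) (at t)" using tendsto_cadj[OF q] by simp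
  then show ?thesis using q tendsto_unique trivial_limit_at by blast
qed

text \<open>The inner partial derivative \<open>G\<close> contains the factor
  \<open>renyi_grad\<close>, which vanishes at \<open>\<theta>\<close> and is differentiable there.
  In the difference quotient of \<open>G\<close> this factor tends to \<open>Z\<close>, while for
  \<open>C\<close> and \<open>Q\<close> continuity suffices. The trace of
  \<open>Z ** C \<theta>\<close> is then computed in the basis \<open>U\<close>.\<close>

lemma renyi_hessian_eq:
  fixes \<rho> :: "real ^ 'l \<Rightarrow> complex ^ 'n ^ 'n" and f' :: "real ^ 'l \<Rightarrow> (real ^ 'l) \<Rightarrow>\<^sub>L (complex ^ 'n ^ 'n)"
  assumes f': "\<And>x. (\<rho> has_derivative blinfun_apply (f' x)) (at x)" "isCont f' \<theta>"
    and tr: "\<And>\<theta>. trace (\<rho> \<theta>) = 1" and pos: "\<And>\<theta>. pos_def (\<rho> \<theta>)"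
    and U: "diagonalizes U d (\<rho> \<theta>)" and \<alpha>: "\<alpha> > 0" "\<alpha> \<noteq> 1"
  defines "h \<equiv> \<lambda>i p. (cadj U ** blinfun_apply (f' \<theta>) (axis i 1) ** U) $ fst p $ snd p"
  shows "renyi_hessian \<rho> \<alpha> \<theta> $ i $ j =
    (\<Sum>p\<in>UNIV. info_kernel \<alpha> (d (fst p)) (d (snd p)) * Re (h i p * cnj (h j p)))"
proof -
  define r where "r = (1 - \<alpha>) / \<alpha>"
  define K where "K = (\<lambda>j x. blinfun_apply (f' x) (axis j 1))"
  have curve: "((\<lambda>t. \<rho> (x + t *\<^sub>R axis j 1)) has_vector_derivative K j x) (at 0)" for x j
  proof -
    have "((\<lambda>t. x + t *\<^sub>R axis j 1) has_derivative (\<lambda>t. t *\<^sub>R axis j 1)) (at 0)"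
      by (auto intro!: derivative_eq_intros)
    from has_derivative_compose[OF this, of \<rho> "blinfun_apply (f' x)"]
    have "((\<lambda>t. \<rho> (x + t *\<^sub>R axis j 1)) has_derivative (\<lambda>t. blinfun_apply (f' x) (t *\<^sub>R axis j 1))) (at 0)"
      using f'(1)[of x] by simp
    then show ?thesis by (simp add: has_vector_derivative_def K_def blinfun.scaleR_right)
  qed
  define C where "C = (\<lambda>x. doi (powr_dd r) (\<rho> x) (\<rho> x) (K j x))"
  define Q where "Q = (\<lambda>x. Re (trace (mat_powr (sandwich \<alpha> (\<rho> \<theta>) (\<rho> x)) \<alpha>)))"
  define F where "F = (\<lambda>\<epsilon>. sandwiched_renyi \<alpha> (\<rho> \<theta>) (\<rho> (\<theta> + \<epsilon>)))"
  define G where "G = (\<lambda>x. 1 / (\<alpha> - 1) * (\<alpha> * Re (trace (renyi_grad \<alpha> (\<rho> \<theta>) (\<rho> x) ** C x)) / Q x))"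
  \<comment> \<open>The inner derivative is established at every point, because the outer one
    differentiates it along the axis \<open>i\<close>.\<close>
  have G: "partial j F x = G (\<theta> + x)" for x
    using has_derivative_sandwiched_renyi[OF pos[of \<theta>] pos tr curve[of "\<theta> + x" j] \<alpha>(1)]
    unfolding partial_def F_def G_def C_def Q_def r_def by (intro DERIV_imp_deriv) (simp add: add.assoc)
  define \<sigma> where "\<sigma> = (\<lambda>t. \<rho> (\<theta> + t *\<^sub>R axis i 1))"
  have \<sigma>0: "\<sigma> 0 = \<rho> \<theta>" by (simp add: \<sigma>_def)
  have d\<sigma>: "(\<sigma> has_vector_derivative K i \<theta>) (at 0)" unfolding \<sigma>_def by (rule curve)
  obtain Z where Z: "((\<lambda>u. renyi_grad \<alpha> (\<rho> \<theta>) (\<sigma> u)) has_vector_derivative Z) (at 0)"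
    and Zkl: "\<And>k l. complex_of_real (1 / (\<alpha> - 1)) * ((cadj U ** Z ** U) $ k $ l * complex_of_real (powr_dd r (d l) (d k)))
       = complex_of_real (info_kernel \<alpha> (d k) (d l)) * (cadj U ** K i \<theta> ** U) $ k $ l"
    using has_vector_derivative_renyi_grad[of \<sigma> "K i \<theta>" 0 U d \<alpha>] pos d\<sigma> U \<alpha>
    unfolding \<sigma>0 r_def by (auto simp: \<sigma>_def)
  have line: "((\<lambda>t. \<theta> + t *\<^sub>R axis i 1) \<longlongrightarrow> \<theta>) (at 0)"
    by (auto intro!: tendsto_eq_intros)
  have Kc: "((\<lambda>t. K j (\<theta> + t *\<^sub>R axis i 1)) \<longlongrightarrow> K j \<theta>) (at 0)"
    unfolding K_def by (intro blinfun.tendsto tendsto_const isCont_tendsto_compose[OF f'(2) line])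
  have \<sigma>c: "(\<sigma> \<longlongrightarrow> \<rho> \<theta>) (at 0)"
    using has_vector_derivative_continuous[OF d\<sigma>] by (simp add: isCont_def \<sigma>0)
  have Cc: "((\<lambda>t. C (\<theta> + t *\<^sub>R axis i 1)) \<longlongrightarrow> C \<theta>) (at 0)"
    unfolding C_def using \<sigma>c Kc by (intro tendsto_doi isCont_powr_dd pos) (simp_all add: \<sigma>_def)
  \<comment> \<open>Continuity comes from differentiability of the power along the curve; the value
    at \<open>0\<close> is the trace of \<open>\<rho> \<theta>\<close>.\<close>
  have Qc: "((\<lambda>t. Q (\<theta> + t *\<^sub>R axis i 1)) \<longlongrightarrow> 1) (at 0)"
  proof -
    have "((\<lambda>t. mat_powr (sandwich \<alpha> (\<rho> \<theta>) (\<sigma> t)) \<alpha>) has_vector_derivative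
       doi (powr_dd \<alpha>) (sandwich \<alpha> (\<rho> \<theta>) (\<sigma> 0)) (sandwich \<alpha> (\<rho> \<theta>) (\<sigma> 0))
         (mat_powr (\<sigma> 0) ((1 - \<alpha>) / (2 * \<alpha>)) ** \<rho> \<theta> ** doi (powr_dd ((1 - \<alpha>) / (2 * \<alpha>))) (\<sigma> 0) (\<sigma> 0) (K i \<theta>)
          + doi (powr_dd ((1 - \<alpha>) / (2 * \<alpha>))) (\<sigma> 0) (\<sigma> 0) (K i \<theta>) ** \<rho> \<theta> ** mat_powr (\<sigma> 0) ((1 - \<alpha>) / (2 * \<alpha>)))) (at 0)"
      using d\<sigma> pos
      by (intro has_vector_derivative_mat_powr has_vector_derivative_sandwich pos_def_sandwich) (auto simp: \<sigma>_def)
    from isContD[OF has_vector_derivative_continuous[OF this]]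
    have "((\<lambda>t. mat_powr (sandwich \<alpha> (\<rho> \<theta>) (\<sigma> t)) \<alpha>) \<longlongrightarrow> \<rho> \<theta>) (at 0)"
      by (simp add: \<sigma>0 mat_powr_sandwich_self pos \<alpha>)
    from bounded_linear.tendsto[OF bounded_linear_Re_trace this] show ?thesis
      by (simp add: Q_def \<sigma>_def tr)
  qed
  have G0: "G \<theta> = 0" by (simp add: G_def renyi_grad_self pos \<alpha> trace_def)
  have "((\<lambda>t. (1 / (t - 0)) *\<^sub>R (renyi_grad \<alpha> (\<rho> \<theta>) (\<sigma> t) - renyi_grad \<alpha> (\<rho> \<theta>) (\<sigma> 0))) \<longlongrightarrow> Z) (at 0)"
    using Z unfolding has_vector_derivative_iff_quotient .
  then have "((\<lambda>t. (1 / t) *\<^sub>R renyi_grad \<alpha> (\<rho> \<theta>) (\<sigma> t)) \<longlongrightarrow> Z) (at 0)"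
    by (simp add: \<sigma>0 renyi_grad_self pos \<alpha>)
  from bounded_linear.tendsto[OF bounded_linear_Re_trace cmatrix_mult.tendsto[OF this Cc]]
  have "((\<lambda>t. 1 / t * Re (trace (renyi_grad \<alpha> (\<rho> \<theta>) (\<sigma> t) ** C (\<theta> + t *\<^sub>R axis i 1)))) \<longlongrightarrow> Re (trace (Z ** C \<theta>))) (at 0)"
    by (simp only: cmatrix_mult.scaleR_left trace_scaleR scaleR_complex.simps)
  from tendsto_mult[OF tendsto_const[of "1 / (\<alpha> - 1) * \<alpha>"] tendsto_divide[OF this Qc]]
  have "((\<lambda>t. (G (\<theta> + t *\<^sub>R axis i 1) - G (\<theta> + 0 *\<^sub>R axis i 1)) / (t - 0)) \<longlongrightarrow> 1 / (\<alpha> - 1) * \<alpha> * Re (trace (Z ** C \<theta>))) (at 0)"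
    by (simp add: G0) (simp add: G_def \<sigma>_def mult_ac)
  then have "((\<lambda>t. G (\<theta> + t *\<^sub>R axis i 1)) has_real_derivative 1 / (\<alpha> - 1) * \<alpha> * Re (trace (Z ** C \<theta>))) (at 0)"
    unfolding has_field_derivative_iff .
  then have "partial i (partial j F) 0 = 1 / (\<alpha> - 1) * \<alpha> * Re (trace (Z ** C \<theta>))"
    unfolding partial_def[of i] by (intro DERIV_imp_deriv) (simp add: G)
  \<comment> \<open>The \<open>\<alpha>\<close> from differentiating the power cancels the
    normalisation \<open>1 / \<alpha>\<close>.\<close>
  then have "renyi_hessian \<rho> \<alpha> \<theta> $ i $ j = 1 / (\<alpha> - 1) * Re (trace (Z ** C \<theta>))"
    using \<alpha> by (simp add: renyi_hessian_def F_def)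
  also have "trace (Z ** C \<theta>) = trace (cadj U ** (Z ** C \<theta>) ** U)"
    using U by (simp add: trace_unitary_conj diagonalizes_def)
  also have "\<dots> = (\<Sum>k\<in>UNIV. \<Sum>l\<in>UNIV. (cadj U ** Z ** U) $ k $ l *
       (complex_of_real (powr_dd r (d l) (d k)) * (cadj U ** K j \<theta> ** U) $ l $ k))"
  proof -
    have "unitary U" using U by (simp add: diagonalizes_def)
    then show ?thesis by (simp add: C_def unitary_conj_mult trace_mult_conv_sum conj_doi[OF U])
  qed
  also have "1 / (\<alpha> - 1) * Re \<dots> =
     (\<Sum>k\<in>UNIV. \<Sum>l\<in>UNIV. Re (complex_of_real (1 / (\<alpha> - 1)) * ((cadj U ** Z ** U) $ k $ l * complex_of_real (powr_dd r (d l) (d k)))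
        * (cadj U ** K j \<theta> ** U) $ l $ k))"
    by (simp only: sum_distrib_left Re_sum mult.assoc Re_of_real_mult)
  also have "\<dots> = (\<Sum>k\<in>UNIV. \<Sum>l\<in>UNIV. info_kernel \<alpha> (d k) (d l) * Re (h i (k, l) * cnj (h j (k, l))))"
  proof -
    have herm: "cadj (cadj U ** K j \<theta> ** U) = cadj U ** K j \<theta> ** U"
      using hermitian_vector_derivative[OF pos_def_hermitian[OF pos] curve[of \<theta> j]]
      by (simp add: cadj_mult matrix_mul_assoc)
    have hK: "(cadj U ** K i \<theta> ** U) $ k $ l = h i (k, l)" for i k l
      by (simp only: h_def K_def fst_conv snd_conv)
    \<comment> \<open>Tangents of Hermitian curves are Hermitian, which turns the transposed entry
      into a conjugate and produces the form that \<open>loewner_le_kernel\<close> expects.\<close>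
    have sym: "(cadj U ** K j \<theta> ** U) $ l $ k = cnj (h j (k, l))" for k l
      using cadj_nth[of "cadj U ** K j \<theta> ** U" l k] unfolding herm hK .
    show ?thesis
      unfolding Zkl sym unfolding hK by (simp only: mult.assoc Re_of_real_mult)
  qed
  also have "\<dots> = (\<Sum>p\<in>UNIV. info_kernel \<alpha> (d (fst p)) (d (snd p)) * Re (h i p * cnj (h j p)))"
    by (simp add: sum.cartesian_product UNIV_Times_UNIV case_prod_beta)
  finally show ?thesis .
qed

text \<open>At \<open>\<alpha> = 1\<close> the formula holds for all nearby
  \<open>\<beta> \<noteq> 1\<close>, and its kernel converges for each pair of eigenvalues, so
  \<open>Lim\<close> takes the expected value.\<close>

lemma sandwiched_info_eq:
  fixes \<rho> :: "real ^ 'l \<Rightarrow> complex ^ 'n ^ 'n" and f' :: "real ^ 'l \<Rightarrow> (real ^ 'l) \<Rightarrow>\<^sub>L (complex ^ 'n ^ 'n)"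
  assumes f': "\<And>x. (\<rho> has_derivative blinfun_apply (f' x)) (at x)" "isCont f' \<theta>"
    and tr: "\<And>\<theta>. trace (\<rho> \<theta>) = 1" and pos: "\<And>\<theta>. pos_def (\<rho> \<theta>)"
    and U: "diagonalizes U d (\<rho> \<theta>)" and \<alpha>: "\<alpha> > 0"
  defines "h \<equiv> \<lambda>i p. (cadj U ** blinfun_apply (f' \<theta>) (axis i 1) ** U) $ fst p $ snd p"
  shows "sandwiched_info \<rho> \<alpha> \<theta> $ i $ j =
    (\<Sum>p\<in>UNIV. info_kernel \<alpha> (d (fst p)) (d (snd p)) * Re (h i p * cnj (h j p)))"
proof (cases "\<alpha> = 1")
  case False
  then show ?thesis
    using renyi_hessian_eq[OF f' tr pos U \<alpha> False] by (simp add: sandwiched_info_def h_def)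
next
  case True
  let ?I = "\<lambda>\<alpha>. \<chi> i j. \<Sum>p\<in>UNIV. info_kernel \<alpha> (d (fst p)) (d (snd p)) * Re (h i p * cnj (h j p))"
  have "\<forall>\<^sub>F \<beta> in at 1. \<beta> > (0 :: real)"
    using order_tendstoD(1)[OF tendsto_ident_at, of 0 "1::real" UNIV] by simp
  then have "\<forall>\<^sub>F \<beta> in at 1. ?I \<beta> = renyi_hessian \<rho> \<beta> \<theta>"
    using eventually_neq_at_within[of 1 "1::real" UNIV]
    by eventually_elim (simp add: vec_eq_iff renyi_hessian_eq[OF f' tr pos U] h_def)
  moreover have "(?I \<longlongrightarrow> ?I 1) (at 1)"
    by (intro tendsto_intros tendsto_info_kernel_1 pos_def_eigenvalues[OF U pos])
  ultimately have "((\<lambda>\<beta>. renyi_hessian \<rho> \<beta> \<theta>) \<longlongrightarrow> ?I 1) (at 1)"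
    by (rule Lim_transform_eventually[rotated])
  then have "sandwiched_info \<rho> 1 \<theta> = ?I 1"
    unfolding sandwiched_info_def by (simp add: tendsto_Lim)
  then show ?thesis unfolding True by simp
qed

theorem theorem30:
  fixes \<rho> :: "real ^ 'l \<Rightarrow> complex ^ 'n ^ 'n"
  assumes "twice_differentiable \<rho>"
    and "\<And>\<theta>. state (\<rho> \<theta>)"
    and "\<And>\<theta>. pos_def (\<rho> \<theta>)"
  shows "\<forall>\<theta>. monotone_on {0<..} (\<le>) loewner_le (\<lambda>\<alpha>. sandwiched_info \<rho> \<alpha> \<theta>)"
proof (intro allI monotone_onI)
  fix \<theta> and \<alpha> \<beta> :: real
  assume \<alpha>: "\<alpha> \<in> {0<..}" "\<beta> \<in> {0<..}" "\<alpha> \<le> \<beta>"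
  obtain f' :: "real ^ 'l \<Rightarrow> (real ^ 'l) \<Rightarrow>\<^sub>L (complex ^ 'n ^ 'n)" where
    f': "\<And>x. (\<rho> has_derivative blinfun_apply (f' x)) (at x)" and "f' differentiable (at \<theta>)"
    using assms(1) unfolding twice_differentiable_def by blast
  then have cont: "isCont f' \<theta>" by (simp add: differentiable_imp_continuous_within)
  have tr: "trace (\<rho> \<theta>) = 1" for \<theta> using assms(2) by (simp add: state_def)
  obtain U d where U: "diagonalizes U d (\<rho> \<theta>)"
    using diagonalizes_exists[OF pos_def_hermitian[OF assms(3)]] by blast
  show "loewner_le (sandwiched_info \<rho> \<alpha> \<theta>) (sandwiched_info \<rho> \<beta> \<theta>)"
    \<comment> \<open>The eigenbasis, the eigenvalues and the entries \<open>h\<close> depend on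
      \<open>\<theta>\<close> alone, so the two information matrices differ only in the
      kernel.\<close>
    using \<alpha>
    by (intro loewner_le_kernel[OF sandwiched_info_eq[OF f' cont tr assms(3) U]
          sandwiched_info_eq[OF f' cont tr assms(3) U]]
        info_kernel_mono pos_def_eigenvalues[OF U assms(3)]) auto
qed

end
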